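(* Suppose (A1)–(A4) hold, that $r_0$ satisfies the RUC radius condition stated in the context, that $\delta,\rho>0$ satisfy $(c+1)\delta+\rho\le r_0$, that $|\mathcal B_i^t|\equiv B_i=\tau_i$ for all $i\in[m]$, and that $\theta\ge\theta_0:=28+\frac{1424}{(1-\eta)^2}+\frac{9600}{(1-\eta)^4}$. Suppose in addition that there is a constant $\bar L>0$ such that $L_{\min}^t\le\bar L$ for all $t\ge0$. Then for every $T\ge1$ the iterates of CGTVR-stag satisfy $$\mathbb E\big[\|\mathcal G(\bar x^{t_{\rm out}})\|^2\big]\le\frac{32\,\theta^2\bar L\,\Delta_f}{(\theta-2)T}\qquad\text{and}\qquad\mathbb E\Big[\frac1m\Big\|x_i^{t_{\rm out}}-\frac1m\sum_{j=1}^mx_j^{t_{\rm out}}\Big\|^2\Big]\le\frac{4\Delta_f}{3T}\quad\text{for each } i\in[m],$$ where $t_{\rm out}$ is selected uniformly at random from $\{0,1,\dots,T-1\}$, independently of the algorithm.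
   Context: **Notation.** $\|\cdot\|$ is the Euclidean norm for vectors and the spectral norm for matrices; $\|\cdot\|_F$ is the Frobenius norm; $[m]=\{1,\dots,m\}$; $\mathbf 1$ is the all-one vector; $B(x,r)$ is the closed ball of center $x$ and radius $r$; $\mathcal P(\mathbb R^d)$ is the family of nonempty compact subsets of $\mathbb R^d$; $d_{\rm H}$ is the Hausdorff distance. A set function $F:\mathcal P(\mathbb R^d)\to\mathbb R_{++}$ is RUC (relative uniform continuous) if for every $\epsilon>0$ there is $\delta>0$ such that $\big|1-\max\{F(\mathcal X)/F(\mathcal Y),F(\mathcal Y)/F(\mathcal X)\}\big|\le\epsilon$ whenever $d_{\rm H}(\mathcal X,\mathcal Y)\le\delta$. **Problem.** Minimize $f(x)=\frac1m\sum_{i=1}^m f_i(x)$ over $x\in\mathbb R^d$, where $f_i=\frac1{n_i}\sum_{j=1}^{n_i}f_{i,j}$ and each $f_{i,j}:\mathbb R^d\to\mathbb R$ is differentiable. **Assumptions.** (A1) For each $i\in[m]$ there is $\mathbb L_i:\mathcal P(\mathbb R^d)\to\mathbb R_{++}$ with $\frac1{n_i}\sum_{j}\|\nabla f_{i,j}(x)-\nabla f_{i,j}(x')\|^2\le\mathbb L_i(\mathcal X)^2\|x-x'\|^2$ for all $x,x'\in\mathcal X$ and all $\mathcal X\in\mathcal P(\mathbb R^d)$; $\mathbb L_i(\mathcal X)\le\mathbb L_i(\mathcal Y)$ if $\mathcal X\subseteq\mathcal Y$; $\mathbb L_i(\mathcal X\cup\mathcal Y)=\max\{\mathbb L_i(\mathcal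 X),\mathbb L_i(\mathcal Y)\}$; and $\mathbb L_i\ge1$. (A2) Each $\mathbb L_i$ is RUC. (A3) $f^*:=\inf_x f(x)>-\infty$. (A4) The mixing matrix $W\in\mathbb R^{m\times m}$ of the undirected network with node set $[m]$ and edge set $\mathcal E$ satisfies $W_{ij}=0$ for $(i,j)\notin\mathcal E$ and $W_{ij}>0$ otherwise, $W\mathbf 1=W^\top\mathbf 1=\mathbf 1$, and $\|W-\frac1m\mathbf 1\mathbf 1^\top\|=\eta\in(0,1)$. **Constants.** $\mathbb L:=\max_i\mathbb L_i$, $c:=\frac{2\sqrt{2m}}{1-\eta}$, $\gamma:=\min\{2,\frac{1+\eta}{2\eta}\}$. RUC radius condition: $r_0>0$ is such that $\gamma^{-1}\le\mathbb L_i(\mathcal X)/\mathbb L_i(\mathcal Y)\le\gamma$ for all $i\in[m]$ and all $\mathcal X,\mathcal Y$ with $d_{\rm H}(\mathcal X,\mathcal Y)\le r_0$ (such $r_0$ exists by (A2)). **Clipping.** For $\beta,\delta>0$: $\mathcal T_\beta^\delta(v)=v/\beta$ if $\|v\|\le\beta\delta$, and $\mathcal T_\beta^\delta(v)=\delta v/\|v\|$ otherwise. **Algorithm CGTVR-stag.** Inputs: common initial point $x_1^0=\dots=x_m^0=x^0$, clipping threshold $\delta>0$, epoch radius $\rho>0$, constants $\theta,r_0>0$, maximum epoch lengths $\tau_i$. Initialize $y_i^{-1}=g_i^{-1}=0$, ${\rm Flag}(i)=$ true, ${\rm Count}(i)=0$. For $t=0,1,2,\dots$, every agent $i$ does: (1)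 If ${\rm Flag}(i)$ is true (a new local epoch starts): $g_i^t=\nabla f_i(x_i^t)$; record the check point $x_i^{\rm c}=x_i^t$; set $L_i^t=\mathbb L(B(x_i^t,r_0))$ and $\beta_i^t=\theta L_i^t$; set ${\rm Flag}(i)=$ false and ${\rm Count}(i)=0$. Otherwise: sample a batch $\mathcal B_i^t$ of indices drawn i.i.d. uniformly from $[n_i]$, independently of all other sampling, set $g_i^t=g_i^{t-1}+\frac1{|\mathcal B_i^t|}\sum_{j\in\mathcal B_i^t}(\nabla f_{i,j}(x_i^t)-\nabla f_{i,j}(x_i^{t-1}))$, and keep $L_i^t=L_i^{t-1}$, $\beta_i^t=\beta_i^{t-1}$. (2) $y_i^t=\sum_jW_{ij}y_j^{t-1}+g_i^t-g_i^{t-1}$. (3) $x_i^{t+1}=\sum_jW_{ij}x_j^t-\mathcal T^\delta_{\beta_i^t}(y_i^t)$. (4) If $\|x_i^{t+1}-x_i^{\rm c}\|\ge\rho$ or ${\rm Count}(i)=\tau_i-1$, set ${\rm Flag}(i)=$ true; otherwise increase ${\rm Count}(i)$ by 1. **Derived quantities.** $\bar x^t=\frac1m\sum_ix_i^t$; $L_{\min}^t=\min_iL_i^t$; $\beta_{\min}^t=\theta L_{\min}^t$; $\mathcal G(\bar x^t):=\beta_{\min}^t\,\mathcal T^\delta_{\beta_{\min}^t}(\nabla f(\bar x^t))$; and $\Delta_f:=f(x^0)-f^*+\frac{5\sum_{i=1}^m\|\nabla f(x^0)-\nabla f_i(x^0)\|^2}{2m(1-\eta)L_{\min}^0}$. $\mathbb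 E$ is expectation over the random batches and $t_{\rm out}$. *)

theory Defs
  imports "HOL-Probability.Probability"
begin

definition grad :: "('a::real_inner \<Rightarrow> real) \<Rightarrow> 'a \<Rightarrow> 'a" where
  "grad f x = (THE D. GDERIV f x :> D)"

text \<open>The family of nonempty compact sets. Set functions on this family are modelled as total
  functions on sets; only their values on this family matter.\<close>

definition ncompacts :: "'a::topological_space set set" where
  "ncompacts = {X. X \<noteq> {} \<and> compact X}"

text \<open>The Hausdorff distance; the suprema are finite for nonempty bounded sets.\<close>

definition hausdorff_dist :: "'a::metric_space set \<Rightarrow> 'a set \<Rightarrow> real" where
  "hausdorff_dist X Y = max (SUP x\<in>X. infdist x Y) (SUP y\<in>Y. infdist y X)"

definition RUC :: "('a::metric_space set \<Rightarrow> real) \<Rightarrow> bool" where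
  "RUC F \<longleftrightarrow> (\<forall>\<epsilon>>0. \<exists>\<delta>>0. \<forall>X\<in>ncompacts. \<forall>Y\<in>ncompacts.
     hausdorff_dist X Y \<le> \<delta> \<longrightarrow> \<bar>1 - max (F X / F Y) (F Y / F X)\<bar> \<le> \<epsilon>)"

definition spectral_norm :: "real^'n^'m \<Rightarrow> real" where
  "spectral_norm A = onorm (\<lambda>v. A *v v)"

definition ones :: "real^'m" where
  "ones = (\<chi> i. 1)"

text \<open>Agents are the elements of a finite type \<^typ>\<open>'m\<close>, so the number of agents is \<open>CARD('m)\<close>;
  \<open>F i j\<close> with \<open>1 \<le> j \<le> n i\<close> are the component functions of agent \<open>i\<close>.\<close>

definition local_obj ::
  "('m \<Rightarrow> nat) \<Rightarrow> ('m \<Rightarrow> nat \<Rightarrow> 'a \<Rightarrow> real) \<Rightarrow> 'm \<Rightarrow> 'a \<Rightarrow> real" where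
  "local_obj n F i x = (1 / real (n i)) * (\<Sum>j=1..n i. F i j x)"

definition global_obj ::
  "('m::finite \<Rightarrow> nat) \<Rightarrow> ('m \<Rightarrow> nat \<Rightarrow> 'a \<Rightarrow> real) \<Rightarrow> 'a \<Rightarrow> real" where
  "global_obj n F x = (1 / real CARD('m)) * (\<Sum>i\<in>UNIV. local_obj n F i x)"

definition avg :: "('m::finite \<Rightarrow> 'a::real_vector) \<Rightarrow> 'a" where
  "avg x = (1 / real CARD('m)) *\<^sub>R (\<Sum>i\<in>UNIV. x i)"

definition clip :: "real \<Rightarrow> real \<Rightarrow> 'a::real_normed_vector \<Rightarrow> 'a" where
  "clip \<beta> \<delta> v = (if norm v \<le> \<beta> * \<delta> then v /\<^sub>R \<beta> else (\<delta> / norm v) *\<^sub>R v)"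

definition Lmax :: "('m::finite \<Rightarrow> 'a set \<Rightarrow> real) \<Rightarrow> 'a set \<Rightarrow> real" where
  "Lmax LL X = (MAX i. LL i X)"

text \<open>The state at the beginning of iteration \<open>t\<close>: the iterates at times \<open>t\<close> and \<open>t - 1\<close>,
  the values of \<open>y\<close>, \<open>g\<close>, \<open>L\<close> from iteration \<open>t - 1\<close>, the current check points,
  flags and counters.\<close>

record ('m, 'a) cgt_state =
  iter :: "'m \<Rightarrow> 'a"
  prev_iter :: "'m \<Rightarrow> 'a"
  prev_y :: "'m \<Rightarrow> 'a"
  prev_g :: "'m \<Rightarrow> 'a"
  prev_L :: "'m \<Rightarrow> real"
  check_pt :: "'m \<Rightarrow> 'a"
  flag :: "'m \<Rightarrow> bool"
  counter :: "'m \<Rightarrow> nat"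

text \<open>The initial values of \<^const>\<open>prev_iter\<close>, \<^const>\<open>prev_L\<close> and \<^const>\<open>check_pt\<close> are
  never read, since all flags are initially true.\<close>

definition init_state :: "'a::real_vector \<Rightarrow> ('m, 'a) cgt_state" where
  "init_state x0 = \<lparr>iter = (\<lambda>i. x0), prev_iter = (\<lambda>i. x0), prev_y = (\<lambda>i. 0), prev_g = (\<lambda>i. 0),
     prev_L = (\<lambda>i. 1), check_pt = (\<lambda>i. x0), flag = (\<lambda>i. True), counter = (\<lambda>i. 0)\<rparr>"

text \<open>The values \<open>L\<^sub>i\<^sup>t\<close>, \<open>g\<^sub>i\<^sup>t\<close>, \<open>y\<^sub>i\<^sup>t\<close> computed in iteration \<open>t\<close> from the state at its beginning.
  The argument \<open>b\<close> holds the sampled indices of the iteration: the batch of agent \<open>i\<close> is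
  \<open>b i 0, \<dots>, b i (B i - 1)\<close>, with repetitions counted.\<close>

definition cur_L ::
  "('m::finite \<Rightarrow> 'a::metric_space set \<Rightarrow> real) \<Rightarrow> real \<Rightarrow> ('m, 'a) cgt_state \<Rightarrow> 'm \<Rightarrow> real" where
  "cur_L LL r0 s i = (if flag s i then Lmax LL (cball (iter s i) r0) else prev_L s i)"

definition cur_g ::
  "('m \<Rightarrow> nat) \<Rightarrow> ('m \<Rightarrow> nat \<Rightarrow> 'a::real_inner \<Rightarrow> real) \<Rightarrow> ('m \<Rightarrow> nat) \<Rightarrow>
   ('m, 'a) cgt_state \<Rightarrow> ('m \<Rightarrow> nat \<Rightarrow> nat) \<Rightarrow> 'm \<Rightarrow> 'a" where
  "cur_g n F B s b i =
     (if flag s i then grad (local_obj n F i) (iter s i)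
      else prev_g s i + (1 / real (B i)) *\<^sub>R
        (\<Sum>k<B i. grad (F i (b i k)) (iter s i) - grad (F i (b i k)) (prev_iter s i)))"

definition cur_y ::
  "real^'m^'m \<Rightarrow> ('m::finite \<Rightarrow> nat) \<Rightarrow> ('m \<Rightarrow> nat \<Rightarrow> 'a::real_inner \<Rightarrow> real) \<Rightarrow> ('m \<Rightarrow> nat) \<Rightarrow>
   ('m, 'a) cgt_state \<Rightarrow> ('m \<Rightarrow> nat \<Rightarrow> nat) \<Rightarrow> 'm \<Rightarrow> 'a" where
  "cur_y W n F B s b i = (\<Sum>j\<in>UNIV. (W $ i $ j) *\<^sub>R prev_y s j) + cur_g n F B s b i - prev_g s i"

definition cgt_step ::
  "real^'m^'m \<Rightarrow> ('m::finite \<Rightarrow> nat) \<Rightarrow> ('m \<Rightarrow> nat \<Rightarrow> 'a::real_inner \<Rightarrow> real) \<Rightarrow>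
   ('m \<Rightarrow> 'a set \<Rightarrow> real) \<Rightarrow> real \<Rightarrow> real \<Rightarrow> real \<Rightarrow> real \<Rightarrow> ('m \<Rightarrow> nat) \<Rightarrow> ('m \<Rightarrow> nat) \<Rightarrow>
   ('m \<Rightarrow> nat \<Rightarrow> nat) \<Rightarrow> ('m, 'a) cgt_state \<Rightarrow> ('m, 'a) cgt_state" where
  "cgt_step W n F LL \<delta> \<rho> \<theta> r0 \<tau> B b s =
    (let L = cur_L LL r0 s;
         g = cur_g n F B s b;
         y = cur_y W n F B s b;
         xc = (\<lambda>i. if flag s i then iter s i else check_pt s i);
         cnt = (\<lambda>i. if flag s i then 0 else counter s i);
         x' = (\<lambda>i. (\<Sum>j\<in>UNIV. (W $ i $ j) *\<^sub>R iter s j) - clip (\<theta> * L i) \<delta> (y i));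
         restart = (\<lambda>i. norm (x' i - xc i) \<ge> \<rho> \<or> cnt i = \<tau> i - 1)
     in \<lparr>iter = x', prev_iter = iter s, prev_y = y, prev_g = g, prev_L = L, check_pt = xc,
         flag = restart, counter = (\<lambda>i. if restart i then cnt i else cnt i + 1)\<rparr>)"

text \<open>The run of the algorithm for given samples: \<open>\<xi> t i k\<close> is the \<open>k\<close>-th index in the batch of
  agent \<open>i\<close> in iteration \<open>t\<close> (ignored if agent \<open>i\<close> starts a new epoch in iteration \<open>t\<close>).\<close>

primrec cgt_run ::
  "real^'m^'m \<Rightarrow> ('m::finite \<Rightarrow> nat) \<Rightarrow> ('m \<Rightarrow> nat \<Rightarrow> 'a::real_inner \<Rightarrow> real) \<Rightarrow>
   ('m \<Rightarrow> 'a set \<Rightarrow> real) \<Rightarrow> real \<Rightarrow> real \<Rightarrow> real \<Rightarrow> real \<Rightarrow> ('m \<Rightarrow> nat) \<Rightarrow> ('m \<Rightarrow> nat) \<Rightarrow>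
   'a \<Rightarrow> (nat \<Rightarrow> 'm \<Rightarrow> nat \<Rightarrow> nat) \<Rightarrow> nat \<Rightarrow> ('m, 'a) cgt_state" where
  "cgt_run W n F LL \<delta> \<rho> \<theta> r0 \<tau> B x0 \<xi> 0 = init_state x0"
| "cgt_run W n F LL \<delta> \<rho> \<theta> r0 \<tau> B x0 \<xi> (Suc t) =
     cgt_step W n F LL \<delta> \<rho> \<theta> r0 \<tau> B (\<xi> t) (cgt_run W n F LL \<delta> \<rho> \<theta> r0 \<tau> B x0 \<xi> t)"

definition Lmin ::
  "('m::finite \<Rightarrow> 'a::metric_space set \<Rightarrow> real) \<Rightarrow> real \<Rightarrow> ('m, 'a) cgt_state \<Rightarrow> real" where
  "Lmin LL r0 s = (MIN i. cur_L LL r0 s i)"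

definition grad_map ::
  "('m::finite \<Rightarrow> nat) \<Rightarrow> ('m \<Rightarrow> nat \<Rightarrow> 'a::real_inner \<Rightarrow> real) \<Rightarrow> ('m \<Rightarrow> 'a set \<Rightarrow> real) \<Rightarrow>
   real \<Rightarrow> real \<Rightarrow> real \<Rightarrow> ('m, 'a) cgt_state \<Rightarrow> 'a" where
  "grad_map n F LL \<delta> \<theta> r0 s =
    (let \<beta> = \<theta> * Lmin LL r0 s in \<beta> *\<^sub>R clip \<beta> \<delta> (grad (global_obj n F) (avg (iter s))))"

text \<open>\<open>L\<^sub>m\<^sub>i\<^sub>n\<close> at time \<open>0\<close> depends on the initial state only, not on any sample.\<close>

definition Delta_f ::
  "('m::finite \<Rightarrow> nat) \<Rightarrow> ('m \<Rightarrow> nat \<Rightarrow> 'a::real_inner \<Rightarrow> real) \<Rightarrow> ('m \<Rightarrow> 'a set \<Rightarrow> real) \<Rightarrow>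
   real \<Rightarrow> real \<Rightarrow> 'a \<Rightarrow> real" where
  "Delta_f n F LL r0 \<eta> x0 =
     global_obj n F x0 - (INF x. global_obj n F x) +
     5 * (\<Sum>i\<in>UNIV. (norm (grad (global_obj n F) x0 - grad (local_obj n F i) x0))\<^sup>2) /
       (2 * real CARD('m) * (1 - \<eta>) * Lmin LL r0 (init_state x0 :: ('m, 'a) cgt_state))"

end

(*
  Write q = 1 - eta, L = min_i L_i^t, and dev for the mean squared deviation of a family of vectors
  from its average. Clipping bounds each update by delta, and W contracts deviations by eta, so
  dev x^t <= (delta / q)^2 along every run. Hence all current and next iterates lie in the ball of
  radius r0 around every current check point; L is therefore a common smoothness constant there,
  and it changes by a factor of at most gamma per iteration.

  With e_i the error of the gradient estimate g_i, and V = (1/m) sum_i (tau_i - Count(i)) |e_i|^2 / L_i,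
  the potential
    f(avg x) + (340 / q^3) L dev(x) + (1 / q) dev(y) / L + (17 / q^2) V
  decreases in conditional expectation, in each iteration, by an amount that dominates both
  |G(avg x)|^2 / (32 theta L) and (3/4) dev(x). The weight tau_i - Count(i) in V works because the
  batch size equals tau_i: an epoch of tau_i steps adds only one full mean squared gradient increment
  of variance. The expectation over a run is a finite sum over uniform index families, so conditional
  expectations are iterated averages.
*)

theory Submission
  imports Defs
begin

subsection \<open>Gradients\<close>

text \<open>The agents restart at different times, so one iteration involves different check points
  and different step sizes theta L_i^t, while the estimates need one scale. Joining two check points
  through an iterate gives L <= L_i^t <= gamma^2 L <= 4 L; this 4 is the origin of the 32 in the
  rate. The potential weights deviations by L or 1/L, and L itself moves by a factor gamma per
  iteration: gamma <= (1 + eta) / (2 eta) is what keeps gamma eta <= 1 - q/2, so that the weighted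
  deviations still contract. The weights form a chain. The errors of the gradient estimates are
  released into y with a factor 4/q, so y at weight 1/q costs 4/q^2 of them; V gives back a quarter
  of its weight 17/q^2, which covers this. The movement of the iterates, as it enters y and V, costs
  168/q^2 times L dev(x); contraction at weight 340/q^3 returns 170/q^2. What remains are squared
  updates of order 1/q^4, and these are paid by theta.\<close>

lemma has_derivative_grad:
  fixes f :: "'a::euclidean_space \<Rightarrow> real"
  assumes "f differentiable (at x)"
  shows "(f has_derivative (\<lambda>h. h \<bullet> grad f x)) (at x)"
proof -
  obtain f' where f': "(f has_derivative f') (at x)"
    using assms by (auto simp: differentiable_def)
  \<comment> \<open>The Riesz vector of \<open>f'\<close>, assembled from its values on the
    basis.\<close>
  define D where "D = (\<Sum>b\<in>Basis. f' b *\<^sub>R b)"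
  have "f' = (\<lambda>h. h \<bullet> D)"
  proof
    fix h
    interpret bounded_linear f' using f' by (rule has_derivative_bounded_linear)
    have "f' h = f' (\<Sum>b\<in>Basis. (h \<bullet> b) *\<^sub>R b)" by (simp add: euclidean_representation)
    also have "\<dots> = h \<bullet> D"
      by (simp add: D_def sum scaleR inner_sum_right mult.commute)
    finally show "f' h = h \<bullet> D" .
  qed
  with f' have D: "GDERIV f x :> D" by (simp add: gderiv_def)
  have "grad f x = D"
    unfolding grad_def
  proof (rule the_equality)
    show "GDERIV f x :> D" by (rule D)
  next
    fix D' assume "GDERIV f x :> D'"
    then have "(\<lambda>h. h \<bullet> D') = (\<lambda>h. h \<bullet> D)"
      using D has_derivative_unique unfolding gderiv_def by blast
    \<comment> \<open>Evaluating both functionals at \<open>D' - D\<close> makes the squared norm of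
      this difference vanish.\<close>
    then have "(D' - D) \<bullet> D' = (D' - D) \<bullet> D" by meson
    then have "(D' - D) \<bullet> (D' - D) = 0" by (simp add: inner_diff_right)
    then show "D' = D" by simp
  qed
  with D show ?thesis by (simp add: gderiv_def)
qed

lemma grad_eqI:
  fixes f :: "'a::euclidean_space \<Rightarrow> real"
  assumes "(f has_derivative (\<lambda>h. h \<bullet> D)) (at x)"
  shows "grad f x = D"
proof -
  have "f differentiable (at x)" using assms by (auto simp: differentiable_def)
  from has_derivative_unique[OF has_derivative_grad[OF this] assms]
  have "(grad f x - D) \<bullet> grad f x = (grad f x - D) \<bullet> D" by meson
  then have "(grad f x - D) \<bullet> (grad f x - D) = 0" by (simp add: inner_diff_right)
  then show ?thesis by simp
qed

lemma has_derivative_scaled_sum_inner: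
  fixes f :: "'i \<Rightarrow> 'a::real_inner \<Rightarrow> real"
  assumes "\<And>j. j \<in> A \<Longrightarrow> (f j has_derivative (\<lambda>h. h \<bullet> D j)) (at x)"
  shows "((\<lambda>y. a * (\<Sum>j\<in>A. f j y)) has_derivative (\<lambda>h. h \<bullet> (a *\<^sub>R (\<Sum>j\<in>A. D j)))) (at x)"
proof -
  have "((\<lambda>y. a * (\<Sum>j\<in>A. f j y)) has_derivative (\<lambda>h. a * (\<Sum>j\<in>A. h \<bullet> D j))) (at x)"
    by (intro has_derivative_mult_right has_derivative_sum assms)
  then show ?thesis by (simp add: inner_sum_right)
qed

text \<open>Smoothness constants are available on balls only, so the Lipschitz bound is asked for on
  a convex set and against the base point \<open>x\<close> alone.\<close>

lemma descent_lemma: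
  fixes f :: "'a::euclidean_space \<Rightarrow> real"
  assumes diff: "\<And>x. f differentiable (at x)"
    and S: "convex S" "x \<in> S" "y \<in> S"
    and lip: "\<And>z. z \<in> S \<Longrightarrow> norm (grad f z - grad f x) \<le> L * norm (z - x)"
  shows "f y \<le> f x + (y - x) \<bullet> grad f x + L / 2 * (norm (y - x))\<^sup>2"
proof -
  define d where "d = y - x"
  \<comment> \<open>Along the segment this is \<open>f\<close> minus its linear part and minus the
    quadratic allowance; the Lipschitz bound makes its derivative nonpositive.\<close>
  define \<phi> where "\<phi> = (\<lambda>s::real. f (x + s *\<^sub>R d) - s * (d \<bullet> grad f x) - L / 2 * s\<^sup>2 * (norm d)\<^sup>2)"
  have "\<phi> 1 \<le> \<phi> 0"
  proof (rule DERIV_nonpos_imp_nonincreasing[of 0 1 \<phi>])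
    fix s :: real assume s: "0 \<le> s" "s \<le> 1"
    define z where "z = x + s *\<^sub>R d"
    have "z \<in> S"
    proof -
      have "z = (1 - s) *\<^sub>R x + s *\<^sub>R y" by (simp add: z_def d_def algebra_simps)
      then show ?thesis using convexD_alt[OF S s] by simp
    qed
    have "((\<lambda>s. f (x + s *\<^sub>R d)) has_derivative (\<lambda>h. (h *\<^sub>R d) \<bullet> grad f z)) (at s)"
      unfolding z_def
      by (rule has_derivative_compose[OF _ has_derivative_grad[OF diff]])
        (auto intro!: derivative_eq_intros)
    then have f_line: "((\<lambda>s. f (x + s *\<^sub>R d)) has_real_derivative (d \<bullet> grad f z)) (at s)"
      unfolding has_field_derivative_def by (rule has_derivative_eq_rhs) (auto simp: mult.commute)
    have D: "(\<phi> has_real_derivative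
        (d \<bullet> grad f z - d \<bullet> grad f x - L * s * (norm d)\<^sup>2)) (at s)"
      unfolding \<phi>_def by (auto intro!: derivative_eq_intros f_line)
    have "d \<bullet> (grad f z - grad f x) \<le> norm d * norm (grad f z - grad f x)"
      by (rule norm_cauchy_schwarz)
    also have "\<dots> \<le> norm d * (L * norm (z - x))"
      by (intro mult_left_mono lip \<open>z \<in> S\<close>) auto
    also have "\<dots> = L * s * (norm d)\<^sup>2" using s by (simp add: z_def power2_eq_square)
    finally show "\<exists>y. (\<phi> has_real_derivative y) (at s) \<and> y \<le> 0"
      using D by (auto simp: inner_diff_right)
  qed simp
  then show ?thesis by (simp add: \<phi>_def d_def)
qed

subsection \<open>Clipping\<close>

lemma norm_clip_le:
  assumes "\<beta> > 0" "\<delta> > 0"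
  shows "norm (clip \<beta> \<delta> v) \<le> \<delta>"
  using assms by (auto simp: clip_def field_simps)

text \<open>In both cases \<open>clip \<beta> \<delta> v\<close> is a multiple of \<open>v\<close>
  with a factor at most \<open>1 / \<beta>\<close>. A clipped step therefore yields at least the
  decrease of an unclipped step of the same length.\<close>

lemma inner_clip_ge:
  assumes "\<beta> > 0" "\<delta> > 0"
  shows "\<beta> * (norm (clip \<beta> \<delta> v))\<^sup>2 \<le> v \<bullet> clip \<beta> \<delta> v"
proof (cases "norm v \<le> \<beta> * \<delta>")
  case True
  then show ?thesis using assms
    by (simp add: clip_def power2_norm_eq_inner power_mult_distrib) (simp add: power2_eq_square field_simps)
next
  case False
  moreover have "norm v > 0" using False assms by (smt (verit) mult_pos_pos)
  ultimately show ?thesis using assms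
    by (simp add: clip_def dot_square_norm) (simp add: power2_eq_square)
qed

lemma norm_scaled_clip:
  assumes "\<beta> > 0" "\<delta> > 0"
  shows "norm (\<beta> *\<^sub>R clip \<beta> \<delta> v) = min (norm v) (\<beta> * \<delta>)"
  using assms by (auto simp: clip_def)

lemma young_inner:
  fixes a b :: "'a::real_inner"
  assumes "\<beta> > 0"
  shows "a \<bullet> b \<le> (norm a)\<^sup>2 / (2 * \<beta>) + \<beta> / 2 * (norm b)\<^sup>2"
proof -
  have "0 \<le> (norm (a - \<beta> *\<^sub>R b))\<^sup>2" by simp
  also have "\<dots> = (norm a)\<^sup>2 + \<beta>\<^sup>2 * (norm b)\<^sup>2 - 2 * \<beta> * (a \<bullet> b)"
    by (simp only: power2_norm_eq_inner)
      (simp add: inner_diff_left inner_diff_right inner_commute power2_eq_square algebra_simps)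
  finally show ?thesis using assms by (simp add: field_simps power2_eq_square)
qed

lemma norm_add_sq_le:
  fixes a b :: "'a::real_inner"
  assumes "0 < e" "e < 1"
  shows "(norm (a + b))\<^sup>2 \<le> (norm a)\<^sup>2 / e + (norm b)\<^sup>2 / (1 - e)"
proof -
  have "(norm (a + b))\<^sup>2 = (norm a)\<^sup>2 + (norm b)\<^sup>2 + 2 * (a \<bullet> b)"
    by (simp add: power2_norm_eq_inner inner_add_left inner_add_right inner_commute)
  also have "2 * (a \<bullet> b) \<le> (norm a)\<^sup>2 * ((1 - e) / e) + (norm b)\<^sup>2 * (e / (1 - e))"
    using young_inner[of "e / (1 - e)" a b] assms by (simp add: field_simps)
  finally show ?thesis using assms by (simp add: field_simps)
qed

lemma norm_add_sq_le_double:
  fixes a b :: "'a::real_inner"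
  shows "(norm (a + b))\<^sup>2 \<le> 2 * (norm a)\<^sup>2 + 2 * (norm b)\<^sup>2"
  using norm_add_sq_le[of "1/2" a b] by simp

text \<open>A clipped vector is compared with a differently clipped, perturbed one through the
  truncated norm \<open>min (norm v) (\<beta> * \<delta>)\<close>, which is monotone in \<open>\<beta>\<close> and 1-Lipschitz in \<open>v\<close>.\<close>

lemma norm_scaled_clip_sq_le:
  fixes v w :: "'a::real_inner"
  assumes "0 < \<beta>" "\<beta> \<le> \<beta>'" "\<beta>' \<le> 4 * \<beta>" "\<delta> > 0"
  shows "(norm (\<beta> *\<^sub>R clip \<beta> \<delta> v))\<^sup>2
    \<le> 8 * \<beta> * (\<beta>' * (norm (clip \<beta>' \<delta> w))\<^sup>2) + 2 * (norm (w - v))\<^sup>2"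
proof -
  have p: "\<beta>' > 0" using assms by simp
  define p where "p = norm (\<beta>' *\<^sub>R clip \<beta>' \<delta> w)"
  have "norm (\<beta> *\<^sub>R clip \<beta> \<delta> v) = min (norm v) (\<beta> * \<delta>)"
    using assms by (simp only: norm_scaled_clip)
  also have "\<dots> \<le> min (norm w) (\<beta>' * \<delta>) + norm (w - v)"
  proof -
    have "norm v \<le> norm w + norm (w - v)" using norm_triangle_ineq4[of w "w - v"] by simp
    moreover have "\<beta> * \<delta> \<le> \<beta>' * \<delta>" using assms by (intro mult_right_mono) auto
    ultimately show ?thesis using norm_ge_zero[of "w - v"] by linarith
  qed
  also have "\<dots> = p + norm (w - v)" using assms p by (simp only: p_def norm_scaled_clip)
  finally have "(norm (\<beta> *\<^sub>R clip \<beta> \<delta> v))\<^sup>2 \<le> (p + norm (w - v))\<^sup>2"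
    by (intro power_mono) auto
  also have "\<dots> \<le> 2 * p\<^sup>2 + 2 * (norm (w - v))\<^sup>2"
    using norm_add_sq_le_double[of p "norm (w - v)"] by simp
  also have "p\<^sup>2 = \<beta>' * (\<beta>' * (norm (clip \<beta>' \<delta> w))\<^sup>2)"
    using p by (simp add: p_def power2_eq_square)
  also have "\<dots> \<le> 4 * \<beta> * (\<beta>' * (norm (clip \<beta>' \<delta> w))\<^sup>2)"
    using assms p by (intro mult_right_mono) auto
  finally show ?thesis by (simp add: mult.assoc)
qed

subsection \<open>Averages and deviations over the agents\<close>

definition msq :: "('m::finite \<Rightarrow> 'a::real_inner) \<Rightarrow> real" where
  "msq v = (1 / real CARD('m)) * (\<Sum>i\<in>UNIV. (norm (v i))\<^sup>2)"

definition dev :: "('m::finite \<Rightarrow> 'a::real_inner) \<Rightarrow> real" where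
  "dev v = msq (\<lambda>i. v i - avg v)"

lemma msq_nonneg: "msq v \<ge> 0"
  by (simp add: msq_def sum_nonneg)

lemma dev_nonneg: "dev v \<ge> 0"
  by (simp add: dev_def msq_nonneg)

lemma avg_const: "avg (\<lambda>i::'m::finite. c :: 'a::real_vector) = c"
  by (simp add: avg_def scaleR_conv_of_real sum_constant_scaleR)

lemma avg_add: "avg (\<lambda>i. v i + w i) = avg v + avg w"
  by (simp add: avg_def sum.distrib scaleR_add_right)

lemma avg_diff: "avg (\<lambda>i. v i - w i) = avg v - avg w"
  by (simp add: avg_def sum_subtractf scaleR_diff_right)

lemma inner_avg: "a \<bullet> avg v = (1 / real CARD('m)) * (\<Sum>i\<in>UNIV. a \<bullet> v i)"
  for v :: "'m::finite \<Rightarrow> 'a::real_inner"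
  by (simp add: avg_def inner_sum_right)

lemma msq_mono:
  fixes v :: "'m::finite \<Rightarrow> 'a::real_inner" and w :: "'m \<Rightarrow> 'b::real_inner"
  assumes "\<And>i. (norm (v i))\<^sup>2 \<le> (norm (w i))\<^sup>2"
  shows "msq v \<le> msq w"
  unfolding msq_def by (intro mult_left_mono sum_mono assms) auto

lemma msq_scaleR: "msq (\<lambda>i. a *\<^sub>R v i) = a\<^sup>2 * msq v"
  by (simp add: msq_def power_mult_distrib sum_distrib_left algebra_simps)

lemma msq_add_le:
  assumes "0 < e" "e < 1"
  shows "msq (\<lambda>i. v i + w i) \<le> msq v / e + msq w / (1 - e)"
proof -
  have "(\<Sum>i\<in>UNIV. (norm (v i + w i))\<^sup>2)
      \<le> (\<Sum>i\<in>UNIV. (norm (v i))\<^sup>2) / e + (\<Sum>i\<in>UNIV. (norm (w i))\<^sup>2) / (1 - e)"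
    unfolding sum_divide_distrib sum.distrib[symmetric]
    by (intro sum_mono norm_add_sq_le assms)
  from divide_right_mono[OF this, of "real CARD('a)"] show ?thesis
    by (simp add: msq_def add_divide_distrib mult.commute)
qed

lemma msq_add_le_double: "msq (\<lambda>i. v i + w i) \<le> 2 * msq v + 2 * msq w"
  using msq_add_le[of "1/2" v w] by simp

lemma msq_diff_le_double: "msq (\<lambda>i. v i - w i) \<le> 2 * msq v + 2 * msq w"
  using msq_add_le_double[of v "\<lambda>i. - w i"] by (simp add: msq_def)

lemma norm_sq_le_msq:
  fixes v :: "'m::finite \<Rightarrow> 'a::real_inner"
  shows "(norm (v i))\<^sup>2 \<le> real CARD('m) * msq v"
proof -
  have "(norm (v i))\<^sup>2 \<le> (\<Sum>i\<in>UNIV. (norm (v i))\<^sup>2)"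
    by (rule member_le_sum) auto
  then show ?thesis by (simp add: msq_def)
qed

text \<open>Bias-variance decomposition: the cross terms cancel because the deviations from the
  average sum to zero. The case \<open>c = 0\<close> compares \<open>dev\<close> with
  \<open>msq\<close>; taking for \<open>c\<close> the gradient of the objective separates the two
  sources of tracking error.\<close>

lemma msq_diff_const:
  fixes v :: "'m::finite \<Rightarrow> 'a::real_inner"
  shows "msq (\<lambda>i. v i - c) = dev v + (norm (avg v - c))\<^sup>2"
proof -
  let ?a = "avg v"
  have "(\<Sum>i\<in>UNIV. (v i - ?a) \<bullet> (?a - c)) = 0"
  proof -
    have "(\<Sum>i\<in>UNIV. v i - ?a) = 0"
      by (simp add: sum_subtractf avg_def sum_constant_scaleR)
    then show ?thesis by (simp add: inner_sum_left[symmetric])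
  qed
  moreover have "(norm (v i - c))\<^sup>2
      = (norm (v i - ?a))\<^sup>2 + 2 * ((v i - ?a) \<bullet> (?a - c)) + (norm (?a - c))\<^sup>2" for i
    by (simp add: power2_norm_eq_inner inner_diff_left inner_diff_right inner_commute)
  ultimately have "(\<Sum>i\<in>UNIV. (norm (v i - c))\<^sup>2)
      = (\<Sum>i\<in>UNIV. (norm (v i - ?a))\<^sup>2) + real CARD('m) * (norm (?a - c))\<^sup>2"
    by (simp only: sum.distrib sum_distrib_left[symmetric]) simp
  then show ?thesis
    by (simp add: msq_def dev_def field_simps)
qed

lemma dev_le_msq: "dev v \<le> msq v"
  using msq_diff_const[of v 0] by simp

lemma norm_avg_sq_le: "(norm (avg v))\<^sup>2 \<le> msq v"
  using msq_diff_const[of v 0] dev_nonneg[of v] by simp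

lemma dev_const: "dev (\<lambda>i::'m::finite. c :: 'a::real_inner) = 0"
  by (simp add: dev_def msq_def avg_const)

text \<open>For distinct agents the two squared deviations are different terms of one sum, hence the
  factor 2 and not 4. This is the origin of the \<open>sqrt (2 * m)\<close> in the constant
  \<open>c\<close>.\<close>

lemma norm_diff_sq_le_dev:
  fixes v :: "'m::finite \<Rightarrow> 'a::real_inner"
  shows "(norm (v i - v j))\<^sup>2 \<le> 2 * real CARD('m) * dev v"
proof (cases "i = j")
  case False
  have "v i - v j = (v i - avg v) + - (v j - avg v)" by simp
  then have "(norm (v i - v j))\<^sup>2 \<le> 2 * (norm (v i - avg v))\<^sup>2 + 2 * (norm (v j - avg v))\<^sup>2"
    using norm_add_sq_le_double[of "v i - avg v" "- (v j - avg v)"]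
    by (metis norm_minus_cancel)
  also have "(norm (v i - avg v))\<^sup>2 + (norm (v j - avg v))\<^sup>2
      = (\<Sum>k\<in>{i, j}. (norm (v k - avg v))\<^sup>2)" using False by simp
  then have "2 * (norm (v i - avg v))\<^sup>2 + 2 * (norm (v j - avg v))\<^sup>2
      = 2 * (\<Sum>k\<in>{i, j}. (norm (v k - avg v))\<^sup>2)" by simp
  also have "\<dots> \<le> 2 * (\<Sum>k\<in>UNIV. (norm (v k - avg v))\<^sup>2)"
    by (intro mult_left_mono sum_mono2) auto
  finally show ?thesis by (simp add: dev_def msq_def)
qed (simp add: dev_nonneg)

section \<open>Mixing by the doubly stochastic matrix\<close>

definition mix :: "real^'m^'m \<Rightarrow> ('m::finite \<Rightarrow> 'a::real_vector) \<Rightarrow> 'm \<Rightarrow> 'a" where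
  "mix W x i = (\<Sum>j\<in>UNIV. (W $ i $ j) *\<^sub>R x j)"

lemma avg_mix:
  fixes x :: "'m::finite \<Rightarrow> 'a::real_vector"
  assumes "transpose W *v ones = ones"
  shows "avg (mix W x) = avg x"
proof -
  have col: "(\<Sum>i\<in>UNIV. W $ i $ j) = 1" for j
    using arg_cong[OF assms, of "\<lambda>v. v $ j"]
    by (simp add: matrix_vector_mult_def transpose_def ones_def)
  have "(\<Sum>i\<in>UNIV. mix W x i) = (\<Sum>j\<in>UNIV. (\<Sum>i\<in>UNIV. W $ i $ j) *\<^sub>R x j)"
    unfolding mix_def scaleR_sum_left by (rule sum.swap)
  then show ?thesis by (simp add: avg_def col)
qed

text \<open>The averaging matrix annihilates deviations, so on them \<open>W\<close> acts like
  \<open>W\<close> minus that matrix, whose norm is \<open>\<eta>\<close>. The norm concerns real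
  vectors indexed by agents; it is applied to each coordinate of the family separately, and the
  coordinates are summed.\<close>

lemma dev_mix_le:
  fixes x :: "'m::finite \<Rightarrow> 'a::euclidean_space"
  assumes row: "W *v ones = ones" and col: "transpose W *v ones = ones"
    and sn: "spectral_norm (W - (\<chi> i j. 1 / real CARD('m))) = \<eta>"
  shows "dev (mix W x) \<le> \<eta>\<^sup>2 * dev x"
proof -
  let ?J = "(\<chi> i j. 1 / real CARD('m)) :: real^'m^'m"
  have row': "(\<Sum>j\<in>UNIV. W $ i $ j) = 1" for i
    using arg_cong[OF row, of "\<lambda>v. v $ i"]
    by (simp add: matrix_vector_mult_def ones_def)
  have J0: "(\<Sum>j\<in>UNIV. x j - avg x) = 0"
    by (simp add: sum_subtractf avg_def sum_constant_scaleR)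
  have *: "mix W x i - avg x = (\<Sum>j\<in>UNIV. ((W - ?J) $ i $ j) *\<^sub>R (x j - avg x))" for i
  proof -
    have "(\<Sum>j\<in>UNIV. ((W - ?J) $ i $ j) *\<^sub>R (x j - avg x))
        = (\<Sum>j\<in>UNIV. (W $ i $ j) *\<^sub>R (x j - avg x))
          - (1 / real CARD('m)) *\<^sub>R (\<Sum>j\<in>UNIV. x j - avg x)"
      by (simp add: scaleR_diff_left sum_subtractf
          scaleR_sum_right[symmetric] scaleR_diff_right del: sum_constant)
    also have "(\<Sum>j\<in>UNIV. (W $ i $ j) *\<^sub>R (x j - avg x)) = mix W x i - avg x"
      by (simp add: mix_def scaleR_diff_right sum_subtractf scaleR_sum_left[symmetric] row')
    finally show ?thesis by (simp add: J0)
  qed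
  have b: "(\<Sum>i\<in>UNIV. ((mix W x i - avg x) \<bullet> b)\<^sup>2)
      \<le> \<eta>\<^sup>2 * (\<Sum>i\<in>UNIV. ((x i - avg x) \<bullet> b)\<^sup>2)" for b
  proof -
    define u :: "real^'m" where "u = (\<chi> j. (x j - avg x) \<bullet> b)"
    have "((W - ?J) *v u) $ i = (mix W x i - avg x) \<bullet> b" for i
      unfolding * u_def matrix_vector_mult_def
      by (simp add: inner_sum_left)
    then have "(\<Sum>i\<in>UNIV. ((mix W x i - avg x) \<bullet> b)\<^sup>2) = (norm ((W - ?J) *v u))\<^sup>2"
      by (simp add: norm_vec_def L2_set_def sum_nonneg)
    also have "\<dots> \<le> (\<eta> * norm u)\<^sup>2"
      unfolding sn[symmetric] spectral_norm_def
      by (intro power_mono onorm matrix_vector_mul_bounded_linear norm_ge_zero)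
    also have "\<dots> = \<eta>\<^sup>2 * (\<Sum>i\<in>UNIV. ((x i - avg x) \<bullet> b)\<^sup>2)"
      by (simp add: power_mult_distrib norm_vec_def L2_set_def sum_nonneg u_def)
    finally show ?thesis .
  qed
  have n2: "(\<Sum>i\<in>UNIV. (norm (w i))\<^sup>2) = (\<Sum>b\<in>Basis. \<Sum>i\<in>UNIV. (w i \<bullet> b)\<^sup>2)"
    for w :: "'m \<Rightarrow> 'a"
  proof -
    have "(norm (w i))\<^sup>2 = (\<Sum>b\<in>Basis. (w i \<bullet> b)\<^sup>2)" for i
      by (subst power2_norm_eq_inner, subst euclidean_inner) (simp add: power2_eq_square)
    then have "(\<Sum>i\<in>UNIV. (norm (w i))\<^sup>2) = (\<Sum>i\<in>UNIV. \<Sum>b\<in>Basis. (w i \<bullet> b)\<^sup>2)"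
      by (intro sum.cong refl)
    also have "\<dots> = (\<Sum>b\<in>Basis. \<Sum>i\<in>UNIV. (w i \<bullet> b)\<^sup>2)" by (rule sum.swap)
    finally show ?thesis .
  qed
  have "(\<Sum>i\<in>UNIV. (norm (mix W x i - avg x))\<^sup>2) \<le> \<eta>\<^sup>2 * (\<Sum>i\<in>UNIV. (norm (x i - avg x))\<^sup>2)"
    unfolding n2 sum_distrib_left[of "\<eta>\<^sup>2"] using b
    by (simp add: sum_mono sum_distrib_left)
  then have "(1 / real CARD('m)) * (\<Sum>i\<in>UNIV. (norm (mix W x i - avg x))\<^sup>2)
      \<le> (1 / real CARD('m)) * (\<eta>\<^sup>2 * (\<Sum>i\<in>UNIV. (norm (x i - avg x))\<^sup>2))"
    by (intro mult_left_mono) auto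
  then show ?thesis
    by (simp add: dev_def msq_def avg_mix[OF col])
qed

text \<open>Splitting the square with weight \<open>\<eta>\<close> costs \<open>1 / \<eta>\<close>
  on the mixed part, which turns the contraction factor \<open>\<eta>\<^sup>2\<close> into
  \<open>\<eta>\<close>. It serves the iterates, perturbed by clipped updates, and \<open>y\<close>,
  perturbed by the increments of the gradient estimates.\<close>

lemma dev_mix_add_le:
  fixes x u :: "'m::finite \<Rightarrow> 'a::euclidean_space"
  assumes W: "W *v ones = ones" "transpose W *v ones = ones"
    "spectral_norm (W - (\<chi> i j. 1 / real CARD('m))) = \<eta>"
    and \<eta>: "0 < \<eta>" "\<eta> < 1"
  shows "dev (\<lambda>i. mix W x i + u i) \<le> \<eta> * dev x + msq u / (1 - \<eta>)"
proof -
  have "dev (\<lambda>i. mix W x i + u i)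
      = msq (\<lambda>i. (mix W x i - avg (mix W x)) + (u i - avg u))"
    by (simp add: dev_def avg_add algebra_simps)
  also have "\<dots> \<le> dev (mix W x) / \<eta> + dev u / (1 - \<eta>)"
    unfolding dev_def using \<eta> by (rule msq_add_le)
  also have "\<dots> \<le> \<eta>\<^sup>2 * dev x / \<eta> + msq u / (1 - \<eta>)"
    using dev_mix_le[OF W, of x] dev_le_msq[of u] \<eta>
    by (intro add_mono divide_right_mono) auto
  finally show ?thesis using \<eta> by (simp add: power2_eq_square)
qed

text \<open>Mixing preserves the average, so the displacement it causes is a difference of
  deviations.\<close>

lemma msq_mix_diff_le:
  fixes x :: "'m::finite \<Rightarrow> 'a::euclidean_space"
  assumes W: "W *v ones = ones" "transpose W *v ones = ones"
    "spectral_norm (W - (\<chi> i j. 1 / real CARD('m))) = \<eta>"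
    and \<eta>: "0 < \<eta>" "\<eta> < 1"
  shows "msq (\<lambda>i. mix W x i - x i) \<le> 4 * dev x"
proof -
  have "msq (\<lambda>i. mix W x i - x i) = msq (\<lambda>i. (mix W x i - avg (mix W x)) - (x i - avg x))"
    by (simp add: avg_mix[OF W(2)])
  also have "\<dots> \<le> 2 * dev (mix W x) + 2 * dev x"
    unfolding dev_def by (rule msq_diff_le_double)
  also have "dev (mix W x) \<le> \<eta>\<^sup>2 * dev x" by (rule dev_mix_le[OF W])
  also have "\<eta>\<^sup>2 * dev x \<le> 1 * dev x"
    using \<eta> dev_nonneg[of x] by (intro mult_right_mono) (auto simp: power_le_one)
  finally show ?thesis by simp
qed


subsection \<open>Expectations over finitely many independent indices\<close>

lemma finite_set_Pi_pmf:
  assumes "finite A" "\<And>x. x \<in> A \<Longrightarrow> finite (set_pmf (p x))"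
  shows "finite (set_pmf (Pi_pmf A d p))"
  using assms by (subst set_Pi_pmf) auto

lemma expectation_mono_finite:
  fixes f g :: "'a \<Rightarrow> real"
  assumes "finite (set_pmf p)" "\<And>x. x \<in> set_pmf p \<Longrightarrow> f x \<le> g x"
  shows "measure_pmf.expectation p f \<le> measure_pmf.expectation p g"
  using assms
  by (intro integral_mono_AE integrable_measure_pmf_finite) (auto simp: AE_measure_pmf_iff)

lemma expectation_pair_pmf_finite:
  fixes h :: "'a \<times> 'b \<Rightarrow> real"
  assumes "finite (set_pmf p)" "finite (set_pmf q)"
  shows "measure_pmf.expectation (pair_pmf p q) h
    = measure_pmf.expectation p (\<lambda>x. measure_pmf.expectation q (\<lambda>y. h (x, y)))"
proof -
  have "measure_pmf.expectation (pair_pmf p q) h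
      = (\<Sum>z\<in>set_pmf p \<times> set_pmf q. h z * pmf (pair_pmf p q) z)"
    using assms by (intro integral_measure_pmf_real) auto
  also have "\<dots> = (\<Sum>x\<in>set_pmf p. \<Sum>y\<in>set_pmf q. h (x, y) * (pmf p x * pmf q y))"
    unfolding sum.cartesian_product by (intro sum.cong refl) (auto simp: pmf_pair)
  also have "\<dots> = (\<Sum>x\<in>set_pmf p. (\<Sum>y\<in>set_pmf q. h (x, y) * pmf q y) * pmf p x)"
    by (simp add: sum_distrib_right sum_distrib_left algebra_simps)
  also have "\<dots> = measure_pmf.expectation p (\<lambda>x. measure_pmf.expectation q (\<lambda>y. h (x, y)))"
    using assms by (subst (1 2) integral_measure_pmf_real) auto
  finally show ?thesis .
qed

text \<open>The finite tower property: with \<open>A\<close> the past indices and \<open>B\<close>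
  the present ones, the inner average is the conditional expectation given the past.\<close>

lemma expectation_Pi_pmf_union:
  fixes h :: "('i \<Rightarrow> 'a) \<Rightarrow> real"
  assumes "finite A" "finite B" "A \<inter> B = {}"
    "\<And>x. x \<in> A \<union> B \<Longrightarrow> finite (set_pmf (p x))"
  shows "measure_pmf.expectation (Pi_pmf (A \<union> B) d p) h
    = measure_pmf.expectation (Pi_pmf A d p)
        (\<lambda>f. measure_pmf.expectation (Pi_pmf B d p) (\<lambda>g. h (\<lambda>x. if x \<in> A then f x else g x)))"
  using assms
  by (subst Pi_pmf_union)
    (auto simp: case_prod_unfold expectation_pair_pmf_finite finite_set_Pi_pmf cong: if_cong)

text \<open>Independent centred vectors are orthogonal in mean square, so the cross terms vanish.
  The offset \<open>a\<close> varies in the induction because the new summand is first absorbed into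
  it.\<close>

lemma expectation_norm_sq_sum_Pi_pmf:
  fixes w :: "'i \<Rightarrow> 'b \<Rightarrow> 'a::euclidean_space"
  assumes "finite A" and fin: "\<And>j. j \<in> A \<Longrightarrow> finite (set_pmf (p j))"
    and mean: "\<And>j. j \<in> A \<Longrightarrow> measure_pmf.expectation (p j) (w j) = 0"
  shows "measure_pmf.expectation (Pi_pmf A d p) (\<lambda>z. (norm (a + (\<Sum>j\<in>A. w j (z j))))\<^sup>2)
    = (norm a)\<^sup>2 + (\<Sum>j\<in>A. measure_pmf.expectation (p j) (\<lambda>r. (norm (w j r))\<^sup>2))"
  using assms
proof (induction A arbitrary: a rule: finite_induct)
  case empty
  then show ?case by simp
next
  case (insert x A)
  let ?q = "Pi_pmf A d p" and ?E = "\<lambda>j. measure_pmf.expectation (p j) (\<lambda>r. (norm (w j r))\<^sup>2)"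
  have fin: "finite (set_pmf ?q)" "finite (set_pmf (p x))"
    using insert by (auto intro!: finite_set_Pi_pmf)
  have int: "integrable (measure_pmf (p x)) f" for f :: "'b \<Rightarrow> real"
    using fin by (intro integrable_measure_pmf_finite)
  have intw: "integrable (measure_pmf (p x)) (w x)"
    using fin by (intro integrable_measure_pmf_finite)
  have "measure_pmf.expectation (Pi_pmf (insert x A) d p)
          (\<lambda>z. (norm (a + (\<Sum>j\<in>insert x A. w j (z j))))\<^sup>2)
      = measure_pmf.expectation (p x) (\<lambda>y. measure_pmf.expectation ?q
          (\<lambda>z. (norm (a + (\<Sum>j\<in>insert x A. w j ((z(x := y)) j))))\<^sup>2))"
    using insert(1,2) fin
    by (simp add: Pi_pmf_insert case_prod_unfold expectation_pair_pmf_finite cong: if_cong)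
  also have "\<dots> = measure_pmf.expectation (p x) (\<lambda>y. measure_pmf.expectation ?q
          (\<lambda>z. (norm ((a + w x y) + (\<Sum>j\<in>A. w j (z j))))\<^sup>2))"
  proof -
    have "(\<Sum>j\<in>insert x A. w j ((z(x := y)) j)) = w x y + (\<Sum>j\<in>A. w j (z j))" for z y
      using insert(1,2) by (auto intro!: sum.cong)
    then show ?thesis by (simp add: add.assoc)
  qed
  also have "\<dots> = measure_pmf.expectation (p x) (\<lambda>y. (norm (a + w x y))\<^sup>2 + (\<Sum>j\<in>A. ?E j))"
    using insert by simp
  also have "\<dots> = measure_pmf.expectation (p x)
      (\<lambda>y. (norm a)\<^sup>2 + 2 * (a \<bullet> w x y) + (norm (w x y))\<^sup>2 + (\<Sum>j\<in>A. ?E j))"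
    by (simp add: power2_norm_eq_inner inner_add_left inner_add_right inner_commute algebra_simps)
  also have "\<dots> = (norm a)\<^sup>2 + 2 * (a \<bullet> measure_pmf.expectation (p x) (w x)) + ?E x
      + (\<Sum>j\<in>A. ?E j)"
    using int intw by simp
  also have "\<dots> = (norm a)\<^sup>2 + (\<Sum>j\<in>insert x A. ?E j)"
    using insert by simp
  finally show ?case .
qed

text \<open>Here \<open>A\<close> is meant for the indices of all agents and \<open>S\<close> for
  the batch of one agent. The quotient by \<open>card S\<close> is the variance reduction that later
  cancels against an epoch length.\<close>

lemma expectation_batch_mean:
  fixes v :: "nat \<Rightarrow> 'a::euclidean_space" and a :: 'a
  assumes A: "finite A" "S \<subseteq> A" "S \<noteq> {}" and N: "N \<ge> 1"
    and p: "\<And>j. j \<in> A \<Longrightarrow> finite (set_pmf (p j))" "\<And>j. j \<in> S \<Longrightarrow> p j = pmf_of_set {1..N}"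
  defines "\<mu> \<equiv> (1 / real N) *\<^sub>R (\<Sum>r=1..N. v r)"
  shows "measure_pmf.expectation (Pi_pmf A d p)
      (\<lambda>z. (norm (a + (1 / real (card S)) *\<^sub>R (\<Sum>j\<in>S. v (z j))))\<^sup>2)
    = (norm (a + \<mu>))\<^sup>2
      + ((1 / real N) * (\<Sum>r=1..N. (norm (v r))\<^sup>2) - (norm \<mu>)\<^sup>2) / real (card S)"
proof -
  have fS: "finite S" using A finite_subset by blast
  then have cS: "real (card S) > 0" using A by (simp add: card_gt_0_iff)
  \<comment> \<open>The centred summands, extended by zero outside \<open>S\<close> so that the sum
    runs over all of \<open>A\<close>.\<close>
  define w where "w = (\<lambda>j r. if j \<in> S then (1 / real (card S)) *\<^sub>R (v r - \<mu>) else 0)"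
  define Q where "Q = (1 / real N) * (\<Sum>r=1..N. (norm (v r))\<^sup>2) - (norm \<mu>)\<^sup>2"
  have N0: "{1..N} \<noteq> {}" using N by auto
  have sv: "(\<Sum>r=1..N. v r) = real N *\<^sub>R \<mu>" using N by (simp add: \<mu>_def)
  have mean: "measure_pmf.expectation (p j) (w j) = 0" if "j \<in> A" for j
  proof (cases "j \<in> S")
    case True
    have "measure_pmf.expectation (p j) (w j) = (\<Sum>r=1..N. (1 / real N) *\<^sub>R w j r)"
      using True N0 N by (subst integral_measure_pmf[of "{1..N}"]) (auto simp: p(2))
    also have "\<dots> = (1 / real N * (1 / real (card S))) *\<^sub>R (\<Sum>r=1..N. v r - \<mu>)"
      using True by (simp add: w_def scaleR_sum_right)
    also have "(\<Sum>r=1..N. v r - \<mu>) = 0"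
      unfolding sum_subtractf sv by (simp add: sum_constant_scaleR)
    finally show ?thesis by simp
  qed (simp add: w_def)
  have var: "measure_pmf.expectation (p j) (\<lambda>r. (norm (w j r))\<^sup>2) = Q / (real (card S))\<^sup>2"
    if "j \<in> S" for j
  proof -
    have "(norm (v r - \<mu>))\<^sup>2 = (norm (v r))\<^sup>2 - 2 * (v r \<bullet> \<mu>) + (norm \<mu>)\<^sup>2" for r
      by (simp add: power2_norm_eq_inner inner_diff_left inner_diff_right inner_commute)
    then have "(\<Sum>r=1..N. (norm (v r - \<mu>))\<^sup>2)
        = (\<Sum>r=1..N. (norm (v r))\<^sup>2) - 2 * ((\<Sum>r=1..N. v r) \<bullet> \<mu>) + real N * (norm \<mu>)\<^sup>2"
      by (simp add: sum.distrib sum_subtractf sum_distrib_left[symmetric] inner_sum_left)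
    also have "(\<Sum>r=1..N. v r) \<bullet> \<mu> = real N * (norm \<mu>)\<^sup>2"
      unfolding sv by (simp add: power2_norm_eq_inner)
    finally have "(\<Sum>r=1..N. (norm (v r - \<mu>))\<^sup>2) / real N = Q"
      using N by (simp add: Q_def field_simps)
    then have "measure_pmf.expectation (pmf_of_set {1..N}) (\<lambda>r. (norm (v r - \<mu>))\<^sup>2) = Q"
      using N0 by (simp add: integral_pmf_of_set)
    then show ?thesis
      using that p(2) by (simp add: w_def power_divide)
  qed
  have S_sum: "(\<Sum>j\<in>A. if j \<in> S then f j else 0) = sum f S" for f :: "_ \<Rightarrow> 'a"
    using A by (simp add: sum.If_cases Int_absorb1)
  have S_sum_real: "(\<Sum>j\<in>A. if j \<in> S then f j else 0) = sum f S" for f :: "_ \<Rightarrow> real"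
    using A by (simp add: sum.If_cases Int_absorb1)
  have "a + (1 / real (card S)) *\<^sub>R (\<Sum>j\<in>S. v (z j)) = (a + \<mu>) + (\<Sum>j\<in>A. w j (z j))" for z
    using cS unfolding w_def S_sum
    by (simp add: scaleR_sum_right[symmetric] sum_subtractf scaleR_diff_right sum_constant_scaleR)
  then have "measure_pmf.expectation (Pi_pmf A d p)
      (\<lambda>z. (norm (a + (1 / real (card S)) *\<^sub>R (\<Sum>j\<in>S. v (z j))))\<^sup>2)
    = (norm (a + \<mu>))\<^sup>2 + (\<Sum>j\<in>A. measure_pmf.expectation (p j) (\<lambda>r. (norm (w j r))\<^sup>2))"
    by (simp only: expectation_norm_sq_sum_Pi_pmf[OF A(1) p(1) mean])
  also have "(\<Sum>j\<in>A. measure_pmf.expectation (p j) (\<lambda>r. (norm (w j r))\<^sup>2))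
      = (\<Sum>j\<in>A. if j \<in> S then Q / (real (card S))\<^sup>2 else 0)"
    using var by (intro sum.cong refl) (auto simp: w_def)
  also have "\<dots> = Q / real (card S)"
    unfolding S_sum_real using cS by (simp add: power2_eq_square)
  finally show ?thesis by (simp add: Q_def)
qed

section \<open>Finite families of independent variables on an arbitrary probability space\<close>

context prob_space
begin

text \<open>Used to drop the constructor \<open>Some\<close> from the family in which the samples
  are joined with the output time.\<close>

lemma indep_vars_reindex:
  assumes inj: "inj_on g I" and X: "indep_vars M' X (g ` I)"
  shows "indep_vars (\<lambda>i. M' (g i)) (\<lambda>i. X (g i)) I"
  unfolding indep_vars_def2
proof (intro conjI ballI)
  show "X (g i) \<in> measurable M (M' (g i))" if "i \<in> I" for i
    using X that by (auto simp: indep_vars_def)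
  define Fs where "Fs = (\<lambda>j. {X j -` A \<inter> space M |A. A \<in> sets (M' j)})"
  have ind: "indep_sets Fs (g ` I)" using X by (simp add: indep_vars_def2 Fs_def)
  show "indep_sets (\<lambda>i. {X (g i) -` A \<inter> space M |A. A \<in> sets (M' (g i))}) I"
    unfolding indep_sets_def
  proof (intro conjI ballI allI impI)
    show "{X (g i) -` A \<inter> space M |A. A \<in> sets (M' (g i))} \<subseteq> events" if "i \<in> I" for i
      using ind that by (auto simp: indep_sets_def Fs_def)
  next
    fix J A
    assume J: "J \<subseteq> I" "J \<noteq> {}" "finite J"
      and A: "A \<in> Pi J (\<lambda>i. {X (g i) -` A \<inter> space M |A. A \<in> sets (M' (g i))})"
    have injJ: "inj_on g J" using inj J(1) by (rule inj_on_subset)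
    define A' where "A' = A \<circ> the_inv_into J g"
    have A': "A' (g i) = A i" if "i \<in> J" for i
      using that injJ by (simp add: A'_def the_inv_into_f_f)
    have "prob (\<Inter>j\<in>g ` J. A' j) = (\<Prod>j\<in>g ` J. prob (A' j))"
      using J A A' by (intro indep_setsD[OF ind]) (auto simp: Fs_def)
    then show "prob (\<Inter>j\<in>J. A j) = (\<Prod>j\<in>J. prob (A j))"
      by (simp add: prod.reindex[OF injJ] A' cong: INF_cong_simp prod.cong)
  qed
qed

text \<open>The target is a countable discrete space, so every real function of the tuple, such as a
  quantity computed by the algorithm, becomes a random variable.\<close>

lemma measurable_restrict_countable:
  fixes X :: "'i \<Rightarrow> 'a \<Rightarrow> 'b::countable"
  assumes "finite J" "\<And>j. j \<in> J \<Longrightarrow> X j \<in> measurable M (count_space UNIV)"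
  shows "(\<lambda>\<omega>. restrict (\<lambda>j. X j \<omega>) J) \<in> measurable M (count_space (PiE J (\<lambda>_. UNIV)))"
proof (subst measurable_count_space_eq_countable, goal_cases)
  case 1
  then show ?case using assms by (intro countable_PiE) auto
next
  case 2
  have "(\<lambda>\<omega>. restrict (\<lambda>j. X j \<omega>) J) -` {a} \<inter> space M
      = {\<omega>\<in>space M. \<forall>j\<in>J. X j \<omega> = a j}" if "a \<in> PiE J (\<lambda>_. UNIV)" for a
    using that by (auto simp: restrict_def PiE_def extensional_def fun_eq_iff)
  moreover have "{\<omega>\<in>space M. \<forall>j\<in>J. X j \<omega> = a j} \<in> sets M" for a
    using assms by measurable
  ultimately show ?case by auto
qed

text \<open>Almost surely the tuple takes one of finitely many values, so \<open>h\<close> of it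
  agrees almost everywhere with a finite combination of indicators; independence gives each value
  the product probability that \<open>Pi_pmf\<close> assigns to it.\<close>

lemma expectation_indep_uniform:
  fixes X :: "'i \<Rightarrow> 'a \<Rightarrow> 'b::countable" and h :: "('i \<Rightarrow> 'b) \<Rightarrow> real"
  assumes ind: "indep_vars (\<lambda>_. count_space UNIV) X I" and J: "finite J" "J \<subseteq> I"
    and R: "\<And>j. j \<in> J \<Longrightarrow> finite (R j) \<and> R j \<noteq> {}"
    and unif: "\<And>j. j \<in> J \<Longrightarrow> distr M (count_space UNIV) (X j) = measure_pmf (pmf_of_set (R j))"
  shows "integrable M (\<lambda>\<omega>. h (restrict (\<lambda>j. X j \<omega>) J))" (is ?int)
    and "expectation (\<lambda>\<omega>. h (restrict (\<lambda>j. X j \<omega>) J))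
      = measure_pmf.expectation (Pi_pmf J undefined (\<lambda>j. pmf_of_set (R j))) h" (is ?eq)
proof -
  define Y where "Y = (\<lambda>\<omega>. restrict (\<lambda>j. X j \<omega>) J)"
  have X: "X j \<in> measurable M (count_space UNIV)" if "j \<in> J" for j
    using ind that J by (auto simp: indep_vars_def)
  have Y: "Y \<in> measurable M (count_space (PiE J (\<lambda>_. UNIV)))"
    unfolding Y_def using J X by (intro measurable_restrict_countable) auto
  have meas: "(\<lambda>\<omega>. g (Y \<omega>)) \<in> borel_measurable M" for g :: "_ \<Rightarrow> real"
    by (rule measurable_compose[OF Y]) simp
  have ev: "prob (X j -` A \<inter> space M) = measure (pmf_of_set (R j)) A" if "j \<in> J" for j A
    using unif[OF that] X[OF that] by (metis measure_distr UNIV_I sets_count_space Pow_UNIV)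
  have AE_R: "AE \<omega> in M. \<forall>j\<in>J. X j \<omega> \<in> R j"
  proof (rule AE_finite_allI[OF J(1)])
    fix j assume j: "j \<in> J"
    have "AE r in distr M (count_space UNIV) (X j). r \<in> R j"
      unfolding unif[OF j] using R[OF j] by (simp add: AE_measure_pmf_iff)
    then show "AE \<omega> in M. X j \<omega> \<in> R j"
      using X[OF j] by (simp add: AE_distr_iff)
  qed
  define P where "P = PiE J R"
  have finP: "finite P" unfolding P_def using J R by (intro finite_PiE) auto
  define S where "S = (\<lambda>z. {\<omega>\<in>space M. Y \<omega> = z})"
  have S: "S z \<in> sets M" for z
  proof (cases "z \<in> PiE J (\<lambda>_. UNIV)")
    case True
    then have "Y -` {z} \<inter> space M \<in> sets M"
      using Y J by (subst (asm) measurable_count_space_eq_countable) (auto intro!: countable_PiE)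
    moreover have "Y -` {z} \<inter> space M = S z" by (auto simp: S_def)
    ultimately show ?thesis by simp
  next
    \<comment> \<open>A restricted tuple is extensional, so it never equals such a
      \<open>z\<close>.\<close>
    case False
    then have "S z = {}" unfolding S_def Y_def by (metis (mono_tags, lifting) Collect_empty_eq
          PiE_restrict UNIV_I restrict_PiE_iff)
    then show ?thesis by simp
  qed
  have probS: "prob (S z) = (\<Prod>j\<in>J. pmf (pmf_of_set (R j)) (z j))" if "z \<in> P" for z
  \<comment> \<open>The empty family is separate: its intersection of events would be
    \<open>UNIV\<close> and not \<open>space M\<close>.\<close>
  proof (cases "J = {}")
    case True
    then have "S z = space M" using that by (auto simp: S_def Y_def P_def)
    with True show ?thesis by (simp add: prob_space)
  next
    case False
    have "S z = (\<Inter>j\<in>J. X j -` {z j} \<inter> space M)"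
      using that False by (auto simp: S_def Y_def P_def PiE_def extensional_def fun_eq_iff)
    also have "prob \<dots> = (\<Prod>j\<in>J. prob (X j -` {z j} \<inter> space M))"
      using ind False J by (intro indep_varsD) auto
    also have "\<dots> = (\<Prod>j\<in>J. pmf (pmf_of_set (R j)) (z j))"
      by (intro prod.cong refl) (simp add: ev measure_pmf_single)
    finally show ?thesis .
  qed
  have AE_eq: "AE \<omega> in M. (\<Sum>z\<in>P. h z * indicator (S z) \<omega>) = h (Y \<omega>)"
    using AE_R AE_space
  proof eventually_elim
    case (elim \<omega>)
    then have "Y \<omega> \<in> P" by (auto simp: Y_def P_def)
    with elim have "(\<Sum>z\<in>P. h z * indicator (S z) \<omega>) = (\<Sum>z\<in>P. if z = Y \<omega> then h z else 0)"
      by (intro sum.cong) (auto simp: S_def indicator_def)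
    with finP \<open>Y \<omega> \<in> P\<close> show "(\<Sum>z\<in>P. h z * indicator (S z) \<omega>) = h (Y \<omega>)" by simp
  qed
  have intS: "integrable M (\<lambda>\<omega>. h z * indicator (S z) \<omega>)" for z
    using S by (intro integrable_mult_right integrable_real_indicator)
      (auto simp: emeasure_eq_measure)
  then have int1: "integrable M (\<lambda>\<omega>. \<Sum>z\<in>P. h z * indicator (S z) \<omega>)"
    by (rule Bochner_Integration.integrable_sum)
  have int2: "integrable M (\<lambda>\<omega>. h (Y \<omega>))"
    using int1 AE_eq meas by (subst integrable_cong_AE[of _ _ "\<lambda>\<omega>. \<Sum>z\<in>P. h z * indicator (S z) \<omega>"]) auto
  then show ?int by (simp add: Y_def)
  have "expectation (\<lambda>\<omega>. h (Y \<omega>)) = expectation (\<lambda>\<omega>. \<Sum>z\<in>P. h z * indicator (S z) \<omega>)"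
    using int1 AE_eq meas by (intro integral_cong_AE) auto
  also have "\<dots> = (\<Sum>z\<in>P. h z * prob (S z))"
    using S intS by (subst Bochner_Integration.integral_sum) auto
  also have "\<dots> = (\<Sum>z\<in>P. h z * pmf (Pi_pmf J undefined (\<lambda>j. pmf_of_set (R j))) z)"
    using J by (intro sum.cong refl) (subst pmf_Pi', auto simp: probS P_def PiE_def extensional_def)
  also have "\<dots> = measure_pmf.expectation (Pi_pmf J undefined (\<lambda>j. pmf_of_set (R j))) h"
  proof (rule integral_measure_pmf_real[symmetric, OF finP])
    fix z assume "z \<in> set_pmf (Pi_pmf J undefined (\<lambda>j. pmf_of_set (R j)))"
    then have "z \<in> PiE_dflt J undefined (set_pmf \<circ> (\<lambda>j. pmf_of_set (R j)))"
      using J by (simp only: set_Pi_pmf)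
    then show "z \<in> P" using R by (auto simp: PiE_dflt_def P_def PiE_def extensional_def)
  qed
  finally show ?eq by (simp add: Y_def)
qed

end


subsection \<open>The invariants of a run\<close>

lemma norm_sq_mean_le:
  fixes v :: "'i \<Rightarrow> 'a::real_inner"
  assumes "finite A" "A \<noteq> {}"
  shows "(norm ((1 / real (card A)) *\<^sub>R (\<Sum>j\<in>A. v j)))\<^sup>2
    \<le> (1 / real (card A)) * (\<Sum>j\<in>A. (norm (v j))\<^sup>2)"
proof -
  have c: "real (card A) > 0" using assms by (simp add: card_gt_0_iff)
  have "(norm (\<Sum>j\<in>A. v j))\<^sup>2 \<le> (\<Sum>j\<in>A. norm (v j))\<^sup>2"
    by (intro power_mono norm_sum) auto
  also have "\<dots> \<le> (\<Sum>j\<in>A. (norm (v j))\<^sup>2) * real (card A)"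
    by (rule sum_squared_le_sum_of_squares)
  finally show ?thesis using c by (simp add: power_divide field_simps power2_eq_square)
qed

lemma convex_mix:
  assumes "W *v ones = ones" "\<And>i j. W $ i $ j \<ge> 0" "convex C" "\<And>j. x j \<in> C"
  shows "mix W x i \<in> C"
proof -
  have "(\<Sum>j\<in>UNIV. W $ i $ j) = 1"
    using arg_cong[OF assms(1), of "\<lambda>v. v $ i"]
    by (simp add: matrix_vector_mult_def ones_def)
  then show ?thesis unfolding mix_def using assms by (intro convex_sum) auto
qed

lemma convex_avg:
  assumes "convex C" "\<And>j. x j \<in> C"
  shows "avg x \<in> C"
  unfolding avg_def scaleR_sum_right using assms by (intro convex_sum) auto

text \<open>Translation by the difference of the centres carries one ball onto the other. Hence the
  radius condition bounds how \<open>LL\<close> changes when a check point moves.\<close>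

lemma hausdorff_dist_cball_le:
  fixes a b :: "'a::real_normed_vector"
  assumes "r \<ge> 0"
  shows "hausdorff_dist (cball a r) (cball b r) \<le> norm (a - b)"
proof -
  have *: "(SUP x\<in>cball a r. infdist x (cball b r)) \<le> norm (a - b)" for a b :: 'a
  proof (rule cSUP_least)
    fix x assume "x \<in> cball a r"
    then have "x + (b - a) \<in> cball b r" by (simp add: dist_norm algebra_simps)
    from infdist_le[OF this, of x] show "infdist x (cball b r) \<le> norm (a - b)"
      by (simp add: dist_norm norm_minus_commute)
  qed (use assms in auto)
  show ?thesis unfolding hausdorff_dist_def
    using *[of a b] *[of b a] by (simp add: norm_minus_commute)
qed

lemma cball_ncompacts: "r \<ge> 0 \<Longrightarrow> cball (a :: 'a::euclidean_space) r \<in> ncompacts"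
  by (auto simp: ncompacts_def)

text \<open>Everything that concerns a single run. Samples enter as arbitrary arguments
  \<open>b\<close>, so the pathwise estimates hold for each of them. The batch size is already
  identified with the epoch length, so \<open>\<tau>\<close> is passed twice in
  \<open>step\<close>.\<close>

locale cgt =
  fixes n :: "'m::finite \<Rightarrow> nat"
    and F :: "'m \<Rightarrow> nat \<Rightarrow> 'a::euclidean_space \<Rightarrow> real"
    and LL :: "'m \<Rightarrow> 'a set \<Rightarrow> real"
    and W :: "real^'m^'m"
    and \<eta> \<gamma> \<delta> \<rho> \<theta> r0 :: real
    and \<tau> :: "'m \<Rightarrow> nat"
  assumes n_pos: "\<And>i. n i \<ge> 1"
    and diff: "\<And>i j x. j \<in> {1..n i} \<Longrightarrow> F i j differentiable (at x)"
    and LL_lip: "\<And>i X x x'. X \<in> ncompacts \<Longrightarrow> x \<in> X \<Longrightarrow> x' \<in> X \<Longrightarrow>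
      (1 / real (n i)) * (\<Sum>j=1..n i. (norm (grad (F i j) x - grad (F i j) x'))\<^sup>2)
        \<le> (LL i X)\<^sup>2 * (norm (x - x'))\<^sup>2"
    and LL_ge1: "\<And>i X. X \<in> ncompacts \<Longrightarrow> LL i X \<ge> 1"
    and bdd: "bdd_below (range (global_obj n F))"
    and W_nonneg: "\<And>i j. W $ i $ j \<ge> 0"
    and W_row: "W *v ones = ones"
    and W_col: "transpose W *v ones = ones"
    and W_norm: "spectral_norm (W - (\<chi> i j. 1 / real CARD('m))) = \<eta>"
    and \<eta>: "0 < \<eta>" "\<eta> < 1"
    and \<gamma>_eq: "\<gamma> = min 2 ((1 + \<eta>) / (2 * \<eta>))"
    and r0_pos: "r0 > 0"
    and r0_radius: "\<And>i X Y. X \<in> ncompacts \<Longrightarrow> Y \<in> ncompacts \<Longrightarrow> hausdorff_dist X Y \<le> r0 \<Longrightarrow>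
      LL i X / LL i Y \<le> \<gamma>"
    and \<delta>_pos: "\<delta> > 0" and \<rho>_pos: "\<rho> > 0"
    and radius: "(2 * sqrt (2 * real CARD('m)) / (1 - \<eta>) + 1) * \<delta> + \<rho> \<le> r0"
    and \<tau>_pos: "\<And>i. \<tau> i \<ge> 1"
    and \<theta>_ge: "\<theta> \<ge> 28 + 1424 / (1 - \<eta>)\<^sup>2 + 9600 / (1 - \<eta>) ^ 4"
begin

abbreviation "f \<equiv> global_obj n F"
abbreviation "fl \<equiv> local_obj n F"
abbreviation "L \<equiv> cur_L LL r0"
abbreviation "Lm \<equiv> Lmin LL r0"
abbreviation "gr \<equiv> cur_g n F \<tau>"
abbreviation "yy \<equiv> cur_y W n F \<tau>"
abbreviation "step \<equiv> cgt_step W n F LL \<delta> \<rho> \<theta> r0 \<tau> \<tau>"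

definition "uu s b i = clip (\<theta> * L s i) \<delta> (yy s b i)"
definition "err s b i = gr s b i - grad (fl i) (iter s i)"
text \<open>The state stores the check point and counter from before a possible restart;
  \<open>xc\<close> and \<open>cnt\<close> are the values in force during the iteration.\<close>

definition "xc s i = (if flag s i then iter s i else check_pt s i)"
definition "cnt s i = (if flag s i then 0 else counter s i)"
text \<open>This is \<open>c * \<delta> / 2\<close>, a bound for the distance between the iterates
  of two agents.\<close>

definition "\<kappa> = sqrt (2 * real CARD('m)) / (1 - \<eta>) * \<delta>"

text \<open>The bound on \<open>dev\<close> is the fixed point of the map from D to
  \<open>\<eta> * D + \<delta>\<^sup>2 / (1 - \<eta>)\<close>, which bounds the deviation after one
  mixing and one clipped update. The equation of averages is what makes \<open>y\<close> track the
  gradient; the last part describes agents inside an epoch.\<close>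

definition inv where
  "inv s \<longleftrightarrow> dev (iter s) \<le> (\<delta> / (1 - \<eta>))\<^sup>2 \<and> avg (prev_y s) = avg (prev_g s) \<and>
    (\<forall>i. \<not> flag s i \<longrightarrow> norm (iter s i - check_pt s i) < \<rho> \<and> counter s i < \<tau> i \<and>
       prev_L s i = Lmax LL (cball (check_pt s i) r0))"

lemma iter_step: "iter (step b s) i = mix W (iter s) i - uu s b i"
  and prev_step: "prev_iter (step b s) = iter s" "prev_y (step b s) = yy s b"
    "prev_g (step b s) = gr s b" "prev_L (step b s) = L s" "check_pt (step b s) = xc s"
  and flag_step: "flag (step b s) i
    \<longleftrightarrow> norm (iter (step b s) i - xc s i) \<ge> \<rho> \<or> cnt s i = \<tau> i - 1"
  and counter_step: "\<not> flag (step b s) i \<Longrightarrow> counter (step b s) i = cnt s i + 1"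
  by (auto simp: cgt_step_def Let_def mix_def uu_def xc_def cnt_def fun_eq_iff)

lemma \<theta>_large: "\<theta> \<ge> 28"
  and \<theta>_pos: "\<theta> > 0"
proof -
  have "1424 / (1 - \<eta>)\<^sup>2 \<ge> 0" "9600 / (1 - \<eta>) ^ 4 \<ge> 0" by auto
  with \<theta>_ge show "\<theta> \<ge> 28" "\<theta> > 0" by linarith+
qed

lemma \<gamma>_bounds: "\<gamma> \<le> 2" "\<gamma> > 0" "\<gamma> * \<eta> \<le> 1 - (1 - \<eta>) / 2"
proof -
  show "\<gamma> \<le> 2" "\<gamma> > 0" using \<eta> by (auto simp: \<gamma>_eq)
  have "\<gamma> * \<eta> \<le> (1 + \<eta>) / (2 * \<eta>) * \<eta>"
    using \<eta> by (intro mult_right_mono) (auto simp: \<gamma>_eq)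
  also have "\<dots> = (1 + \<eta>) / 2" using \<eta> by simp
  finally show "\<gamma> * \<eta> \<le> 1 - (1 - \<eta>) / 2" by (simp add: field_simps)
qed

lemma \<kappa>_nonneg: "\<kappa> \<ge> 0" and \<kappa>_radius: "2 * \<kappa> + \<delta> + \<rho> \<le> r0"
  using \<eta> \<delta>_pos radius by (auto simp: \<kappa>_def algebra_simps)

lemma Lmax_ge: "LL i X \<le> Lmax LL X"
  by (simp add: Lmax_def)

lemma Lmax_cball_ge1: "1 \<le> Lmax LL (cball a r0)"
  using Lmax_ge LL_ge1 r0_pos cball_ncompacts by (meson less_eq_real_def order_trans)

lemma Lmax_cball_le:
  assumes "norm (a - b) \<le> r0"
  shows "Lmax LL (cball a r0) \<le> \<gamma> * Lmax LL (cball b r0)"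
proof -
  have nc: "cball z r0 \<in> ncompacts" for z :: 'a using r0_pos by (simp add: cball_ncompacts)
  have "LL i (cball a r0) \<le> \<gamma> * Lmax LL (cball b r0)" for i
  proof -
    have "hausdorff_dist (cball a r0) (cball b r0) \<le> r0"
      using hausdorff_dist_cball_le[of r0 a b] r0_pos assms by simp
    from r0_radius[OF nc nc this, of i] have "LL i (cball a r0) \<le> \<gamma> * LL i (cball b r0)"
      using LL_ge1[OF nc, of i b] by (simp add: divide_le_eq)
    also have "\<dots> \<le> \<gamma> * Lmax LL (cball b r0)"
      using \<gamma>_bounds by (intro mult_left_mono Lmax_ge) auto
    finally show ?thesis .
  qed
  then show ?thesis by (subst (1) Lmax_def) (auto intro!: Max.boundedI)
qed

lemma Lm_le: "Lm s \<le> L s i"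
  by (simp add: Lmin_def)

lemma Lm_attained: "\<exists>i. L s i = Lm s"
proof -
  have "Lm s \<in> range (L s)" unfolding Lmin_def by (intro Min_in) auto
  then show ?thesis by auto
qed

lemma local_has_derivative:
  "(fl i has_derivative (\<lambda>h. h \<bullet> ((1 / real (n i)) *\<^sub>R (\<Sum>j=1..n i. grad (F i j) x)))) (at x)"
  unfolding local_obj_def[abs_def]
  by (intro has_derivative_scaled_sum_inner has_derivative_grad diff)

lemma grad_local: "grad (fl i) x = (1 / real (n i)) *\<^sub>R (\<Sum>j=1..n i. grad (F i j) x)"
  by (rule grad_eqI[OF local_has_derivative])

lemma global_has_derivative: "(f has_derivative (\<lambda>h. h \<bullet> avg (\<lambda>i. grad (fl i) x))) (at x)"
  unfolding global_obj_def[abs_def] avg_def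
  using local_has_derivative by (intro has_derivative_scaled_sum_inner) (simp add: grad_local)

lemma grad_global: "grad f x = avg (\<lambda>i. grad (fl i) x)"
  by (rule grad_eqI[OF global_has_derivative])

lemma global_differentiable: "f differentiable (at x)"
  using global_has_derivative by (auto simp: differentiable_def)

text \<open>The gradient tracking identity: mixing preserves the average, so \<open>y\<close> and
  \<open>g\<close> receive the same increments on average.\<close>

lemma avg_y_eq_avg_g:
  assumes "inv s"
  shows "avg (yy s b) = avg (gr s b)"
proof -
  have "yy s b = (\<lambda>i. mix W (prev_y s) i + gr s b i - prev_g s i)"
    by (simp add: cur_y_def mix_def fun_eq_iff)
  then have "avg (yy s b) = avg (mix W (prev_y s)) + avg (gr s b) - avg (prev_g s)"
    by (simp add: avg_add avg_diff)
  with assms show ?thesis by (simp add: avg_mix[OF W_col] inv_def)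
qed

section \<open>Geometry and smoothness under the invariant\<close>

context
  fixes s :: "('m, 'a) cgt_state"
  assumes inv: "inv s"
begin

lemma L_eq: "L s i = Lmax LL (cball (xc s i) r0)"
  using inv by (auto simp: cur_L_def xc_def inv_def)

lemma L_ge1: "1 \<le> L s i"
  by (simp add: L_eq Lmax_cball_ge1)

lemma Lm_ge1: "1 \<le> Lm s"
  using Lm_attained[of s] L_ge1 by metis

lemma cnt_less: "cnt s i < \<tau> i"
  using inv \<tau>_pos[of i] by (auto simp: cnt_def inv_def)

lemma norm_uu_le: "norm (uu s b i) \<le> \<delta>"
  unfolding uu_def using \<theta>_pos \<delta>_pos L_ge1[of i] by (intro norm_clip_le) auto

lemma norm_iter_diff_le: "norm (iter s i - iter s j) \<le> \<kappa>"
proof -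
  have "(norm (iter s i - iter s j))\<^sup>2 \<le> 2 * real CARD('m) * dev (iter s)"
    by (rule norm_diff_sq_le_dev)
  also have "\<dots> \<le> 2 * real CARD('m) * (\<delta> / (1 - \<eta>))\<^sup>2"
    using inv by (intro mult_left_mono) (auto simp: inv_def)
  also have "\<dots> = \<kappa>\<^sup>2"
    by (simp add: \<kappa>_def power_mult_distrib power_divide)
  finally show ?thesis using \<kappa>_nonneg by (rule power2_le_imp_le)
qed

lemma norm_iter_xc_less: "norm (iter s i - xc s i) < \<rho>"
  using inv \<rho>_pos by (auto simp: inv_def xc_def)

text \<open>The smaller radius leaves room for the next iterate: mixing stays inside this convex
  ball and the clipped update adds at most \<open>\<delta>\<close>.\<close>

lemma iter_in_small_cball: "iter s j \<in> cball (xc s i) (\<kappa> + \<rho>)"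
proof -
  have "norm (iter s j - xc s i) \<le> norm (iter s j - iter s i) + norm (iter s i - xc s i)"
    by norm
  also have "\<dots> \<le> \<kappa> + \<rho>"
    using norm_iter_diff_le[of j i] norm_iter_xc_less[of i] by linarith
  finally show ?thesis by (simp add: dist_norm norm_minus_commute)
qed

lemma small_cball_subset: "cball (xc s i) (\<kappa> + \<rho>) \<subseteq> cball (xc s i) r0"
  using \<kappa>_radius \<kappa>_nonneg \<delta>_pos by (intro subset_cball) auto

lemma iter_in_cball: "iter s j \<in> cball (xc s i) r0"
  using iter_in_small_cball small_cball_subset by blast

lemma iter_step_in_cball: "iter (step b s) j \<in> cball (xc s i) r0"
proof -
  have "mix W (iter s) j \<in> cball (xc s i) (\<kappa> + \<rho>)"
    by (intro convex_mix W_row W_nonneg iter_in_small_cball) auto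
  then have "norm (mix W (iter s) j - xc s i) \<le> \<kappa> + \<rho>"
    by (simp add: dist_norm norm_minus_commute)
  then have "norm (iter (step b s) j - xc s i) \<le> \<kappa> + \<rho> + \<delta>"
    using norm_uu_le[of b j] norm_triangle_ineq4[of "mix W (iter s) j - xc s i" "uu s b j"]
    by (simp add: iter_step algebra_simps)
  then show ?thesis using \<kappa>_radius \<kappa>_nonneg by (simp add: dist_norm norm_minus_commute)
qed

lemma avg_iter_in_cball: "avg (iter s) \<in> cball (xc s i) r0"
  and avg_iter_step_in_cball: "avg (iter (step b s)) \<in> cball (xc s i) r0"
  by (intro convex_avg iter_in_cball iter_step_in_cball convex_cball)+

lemma inv_step: "inv (step b s)"
proof -
  have "dev (iter (step b s)) = dev (\<lambda>i. mix W (iter s) i + - uu s b i)"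
    by (simp add: iter_step dev_def avg_def)
  also have "\<dots> \<le> \<eta> * dev (iter s) + msq (\<lambda>i. - uu s b i) / (1 - \<eta>)"
    by (intro dev_mix_add_le W_row W_col W_norm \<eta>)
  also have "msq (\<lambda>i. - uu s b i) \<le> msq (\<lambda>i::'m. \<delta>)"
    using norm_uu_le[of b] \<delta>_pos by (intro msq_mono) (auto intro!: power_mono)
  also have "msq (\<lambda>i::'m. \<delta>) = \<delta>\<^sup>2" by (simp add: msq_def)
  also have "dev (iter s) \<le> (\<delta> / (1 - \<eta>))\<^sup>2" using inv by (simp add: inv_def)
  finally have "dev (iter (step b s)) \<le> \<eta> * (\<delta> / (1 - \<eta>))\<^sup>2 + \<delta>\<^sup>2 / (1 - \<eta>)"
    using \<eta> by (simp add: divide_right_mono mult_left_mono)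
  also have "\<delta>\<^sup>2 / (1 - \<eta>) = (1 - \<eta>) * (\<delta> / (1 - \<eta>))\<^sup>2"
    using \<eta> by (simp add: power2_eq_square)
  also have "\<eta> * (\<delta> / (1 - \<eta>))\<^sup>2 + (1 - \<eta>) * (\<delta> / (1 - \<eta>))\<^sup>2 = (\<delta> / (1 - \<eta>))\<^sup>2"
    by (simp add: left_diff_distrib)
  finally have "dev (iter (step b s)) \<le> (\<delta> / (1 - \<eta>))\<^sup>2" .
  \<comment> \<open>An epoch ends when the counter is \<open>\<tau> i - 1\<close>, so an increased
    counter is still below \<open>\<tau> i\<close>.\<close>
  moreover have "Suc (cnt s i) < \<tau> i" if "cnt s i \<noteq> \<tau> i - Suc 0" for i
    using that cnt_less[of i] by linarith
  ultimately show ?thesis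
    using avg_y_eq_avg_g[OF inv, of b]
    by (auto simp: inv_def prev_step flag_step counter_step L_eq not_le)
qed

text \<open>The check point either stays or jumps to the new iterate of the agent, which lies within
  \<open>r0\<close> of the old one; the radius condition covers both cases.\<close>

lemma L_step_le: "L (step b s) i \<le> \<gamma> * L s i" and L_le_step: "L s i \<le> \<gamma> * L (step b s) i"
proof -
  have "L (step b s) i \<le> \<gamma> * L s i \<and> L s i \<le> \<gamma> * L (step b s) i"
  proof -
    have *: "L (step b s) i = Lmax LL (cball (xc (step b s) i) r0)"
      by (simp add: cur_L_def[of _ _ "step b s"] xc_def[of "step b s"] prev_step L_eq)
    have "norm (xc (step b s) i - xc s i) \<le> r0"
      using iter_step_in_cball[of b i i] r0_pos
      by (auto simp: xc_def prev_step dist_norm norm_minus_commute)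
    then show ?thesis unfolding * L_eq
      using Lmax_cball_le norm_minus_commute by metis
  qed
  then show "L (step b s) i \<le> \<gamma> * L s i" "L s i \<le> \<gamma> * L (step b s) i" by auto
qed

text \<open>Both directions are used: deviations of the iterates carry the weight \<open>Lm\<close>,
  those of \<open>y\<close> the weight \<open>1 / Lm\<close>.\<close>

lemma Lm_step_le: "Lm (step b s) \<le> \<gamma> * Lm s" and Lm_le_step: "Lm s \<le> \<gamma> * Lm (step b s)"
  using Lm_attained[of s] Lm_attained[of "step b s"] Lm_le L_step_le[of b] L_le_step[of _ b]
  by (metis order_trans)+

text \<open>Two check points may be further apart than \<open>r0\<close>; the detour through an iterate costs a
  second factor \<open>\<gamma>\<close>.\<close>

lemma L_le_Lm: "L s i \<le> 4 * Lm s"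
proof -
  obtain k where k: "L s k = Lm s" using Lm_attained by blast
  have "Lmax LL (cball (xc s i) r0) \<le> \<gamma> * Lmax LL (cball (iter s i) r0)"
    using norm_iter_xc_less[of i] \<kappa>_radius \<kappa>_nonneg \<delta>_pos
    by (intro Lmax_cball_le) (simp add: norm_minus_commute)
  also have "\<dots> \<le> \<gamma> * (\<gamma> * Lmax LL (cball (xc s k) r0))"
    using iter_in_cball[of i k] \<gamma>_bounds
    by (intro mult_left_mono Lmax_cball_le) (auto simp: dist_norm norm_minus_commute)
  also have "\<dots> = (\<gamma> * \<gamma>) * Lm s" by (simp flip: L_eq k)
  also have "\<dots> \<le> (2 * 2) * Lm s"
    using \<gamma>_bounds Lm_ge1 by (intro mult_right_mono mult_mono) auto
  finally show ?thesis by (simp add: L_eq)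
qed

text \<open>Near points lie in particular in the ball of the agent with the smallest \<open>L\<close>, which therefore
  serves as a smoothness constant of all components.\<close>

definition "near z \<longleftrightarrow> (\<forall>i. z \<in> cball (xc s i) r0)"

lemma near: "near (iter s i)" "near (iter (step b s) i)"
  "near (avg (iter s))" "near (avg (iter (step b s)))"
  using iter_in_cball iter_step_in_cball avg_iter_in_cball avg_iter_step_in_cball
  by (auto simp: near_def)

text \<open>The constant of an agent is a maximum over all agents, so the ball of the agent
  attaining \<open>Lm s\<close> controls the components of every other agent as well.\<close>

lemma component_lip:
  assumes "near z" "near z'"
  shows "(1 / real (n i)) * (\<Sum>j=1..n i. (norm (grad (F i j) z - grad (F i j) z'))\<^sup>2)
    \<le> (Lm s)\<^sup>2 * (norm (z - z'))\<^sup>2"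
proof -
  obtain k where k: "L s k = Lm s" using Lm_attained by blast
  let ?C = "cball (xc s k) r0"
  have nc: "?C \<in> ncompacts" using r0_pos by (simp add: cball_ncompacts)
  have "(1 / real (n i)) * (\<Sum>j=1..n i. (norm (grad (F i j) z - grad (F i j) z'))\<^sup>2)
      \<le> (LL i ?C)\<^sup>2 * (norm (z - z'))\<^sup>2"
    using assms by (intro LL_lip nc) (auto simp: near_def)
  also have "\<dots> \<le> (Lm s)\<^sup>2 * (norm (z - z'))\<^sup>2"
    using Lmax_ge[of i ?C] LL_ge1[OF nc, of i]
    by (intro mult_right_mono power_mono) (auto simp: L_eq simp flip: k)
  finally show ?thesis .
qed

lemma local_lip:
  assumes "near z" "near z'"
  shows "(norm (grad (fl i) z - grad (fl i) z'))\<^sup>2 \<le> (Lm s)\<^sup>2 * (norm (z - z'))\<^sup>2"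
proof -
  have "{1..n i} \<noteq> {}" using n_pos[of i] by auto
  then have "(norm ((1 / real (n i)) *\<^sub>R (\<Sum>j=1..n i. grad (F i j) z - grad (F i j) z')))\<^sup>2
      \<le> (1 / real (n i)) * (\<Sum>j=1..n i. (norm (grad (F i j) z - grad (F i j) z'))\<^sup>2)"
    using norm_sq_mean_le[of "{1..n i}" "\<lambda>j. grad (F i j) z - grad (F i j) z'"] by simp
  also have "\<dots> \<le> (Lm s)\<^sup>2 * (norm (z - z'))\<^sup>2" using assms by (rule component_lip)
  finally show ?thesis by (simp add: grad_local sum_subtractf scaleR_diff_right)
qed

lemma global_lip:
  assumes "near z" "near z'"
  shows "norm (grad f z - grad f z') \<le> Lm s * norm (z - z')"
proof (rule power2_le_imp_le)
  have "(norm (grad f z - grad f z'))\<^sup>2 \<le> msq (\<lambda>i. grad (fl i) z - grad (fl i) z')"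
    unfolding grad_global avg_diff[symmetric] by (rule norm_avg_sq_le)
  also have "\<dots> \<le> msq (\<lambda>i::'m. Lm s * norm (z - z'))"
    using local_lip[OF assms] by (intro msq_mono) (simp add: power_mult_distrib)
  also have "\<dots> = (Lm s * norm (z - z'))\<^sup>2" by (simp add: msq_def)
  finally show "(norm (grad f z - grad f z'))\<^sup>2 \<le> (Lm s * norm (z - z'))\<^sup>2" .
qed (use Lm_ge1 in auto)

lemma convex_near: "convex {z. near z}"
proof -
  have "{z. near z} = (\<Inter>i. cball (xc s i) r0)" by (auto simp: near_def)
  then show ?thesis by (auto intro!: convex_INT)
qed

end

lemma inv_init: "inv (init_state x0)"
  using \<eta> \<delta>_pos by (simp add: inv_def init_state_def dev_const)

end


subsection \<open>One iteration\<close>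

text \<open>Comparison of coefficients with \<open>r = 1 / q \<ge> 1\<close>. For \<open>E\<close>:
  \<open>17/4 * r\<^sup>2\<close> against \<open>4 * r\<^sup>2\<close> and a multiple of
  \<open>1 / \<theta>\<close>. For \<open>X\<close>: \<open>170 * r\<^sup>2\<close> against
  \<open>32 + 8 * 17 = 168\<close> times \<open>r\<^sup>2\<close> and terms of order 1. For
  \<open>Y\<close>: \<open>1/2\<close> against a multiple of \<open>1 / \<theta>\<close>. For
  \<open>T\<close>: \<open>1/2 + (8 + 34) * r\<^sup>2 + 680 * r ^ 4\<close>, absorbed by the quarter
  of \<open>S\<close> that remains.\<close>

lemma potential_arithmetic:
  fixes q \<theta> fv fv' S X Y E T V X' Y' V' :: real
  assumes q: "0 < q" "q \<le> 1" and \<theta>: "\<theta> \<ge> 28 + 1424 / q\<^sup>2 + 9600 / q ^ 4"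
    and nonneg: "X \<ge> 0" "Y \<ge> 0" "E \<ge> 0" "T \<ge> 0" and TS: "\<theta> * T \<le> S"
    and f': "fv' \<le> fv - S / 2 + T / 2 + (Y + 2 * X + 2 * E) / (2 * \<theta>)"
    and X': "X' \<le> (1 - q / 2) * X + 2 / q * T"
    and Y': "Y' \<le> (1 - q / 2) * Y + 4 / q * E + 4 / q * (8 * X + 2 * T)"
    and V': "V' \<le> V - E / 4 + (8 * X + 2 * T)"
  shows "fv' + 340 / q ^ 3 * X' + 1 / q * Y' + 17 / q\<^sup>2 * V'
    \<le> fv + 340 / q ^ 3 * X + 1 / q * Y + 17 / q\<^sup>2 * V
      - (S / 4 + 3 / 4 * X + (Y + 2 * X + 2 * E) / (16 * \<theta>))"
proof -
  define r where "r = 1 / q"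
  have rq: "r * q = 1" and r1: "r \<ge> 1" using q by (auto simp: r_def)
  have r2: "r\<^sup>2 \<ge> 1" using r1 by simp
  have div: "1 / q = r" "17 / q\<^sup>2 = 17 * r\<^sup>2" "340 / q ^ 3 = 340 * r ^ 3" "2 / q = 2 * r" "4 / q = 4 * r"
    by (simp_all add: r_def power_divide)
  have \<theta>r: "\<theta> \<ge> 28 + 1424 * r\<^sup>2 + 9600 * r ^ 4" using \<theta> by (simp add: r_def power_divide)
  then have \<theta>28: "\<theta> \<ge> 28" using r1 by (smt (verit) zero_le_power)
  have rX: "r ^ 3 * X' \<le> r ^ 3 * X - r\<^sup>2 * X / 2 + 2 * r ^ 4 * T"
  proof -
    have "r ^ 3 * X' \<le> r ^ 3 * ((1 - q / 2) * X + 2 * r * T)"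
      using X' r1 unfolding div by (intro mult_left_mono) auto
    also have "\<dots> = r ^ 3 * X - r\<^sup>2 * (r * q) * X / 2 + 2 * r ^ 4 * T"
      by (simp add: algebra_simps power2_eq_square power3_eq_cube power4_eq_xxxx)
    finally show ?thesis by (simp add: rq)
  qed
  have rY: "r * Y' \<le> r * Y - Y / 2 + 4 * r\<^sup>2 * E + 32 * (r\<^sup>2 * X) + 8 * r\<^sup>2 * T"
  proof -
    have "r * Y' \<le> r * ((1 - q / 2) * Y + 4 * r * E + 4 * r * (8 * X + 2 * T))"
      using Y' r1 unfolding div by (intro mult_left_mono) auto
    also have "\<dots> = r * Y - (r * q) * Y / 2 + 4 * r\<^sup>2 * E + 32 * (r\<^sup>2 * X) + 8 * r\<^sup>2 * T"
      by (simp add: algebra_simps power2_eq_square)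
    finally show ?thesis by (simp add: rq)
  qed
  have rV: "r\<^sup>2 * V' \<le> r\<^sup>2 * V - r\<^sup>2 * E / 4 + 8 * (r\<^sup>2 * X) + 2 * r\<^sup>2 * T"
  proof -
    have "r\<^sup>2 * V' \<le> r\<^sup>2 * (V - E / 4 + (8 * X + 2 * T))"
      using V' r1 by (intro mult_left_mono) auto
    then show ?thesis by (simp add: algebra_simps)
  qed
  \<comment> \<open>Naming the quotients by \<open>\<theta>\<close> leaves a linear problem;
    \<open>\<theta> \<ge> 28\<close> bounds each of them.\<close>
  define Et Xt Yt where t_defs: "Et = E / \<theta>" "Xt = X / \<theta>" "Yt = Y / \<theta>"
  have tE: "Et \<le> E / 28" "Xt \<le> X / 28" "Yt \<le> Y / 28"
    unfolding t_defs using \<theta>28 nonneg by (intro divide_left_mono; simp)+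
  have E1: "E \<le> r\<^sup>2 * E" and X1: "X \<le> r\<^sup>2 * X"
    using r2 nonneg mult_right_mono[of 1 "r\<^sup>2"] by auto
  have "(2 + 168 * r\<^sup>2 + 2720 * r ^ 4) * T \<le> \<theta> * T"
  proof (rule mult_right_mono)
    have "r\<^sup>2 \<ge> 0" "r ^ 4 \<ge> 0" by auto
    then show "2 + 168 * r\<^sup>2 + 2720 * r ^ 4 \<le> \<theta>" using \<theta>r by linarith
  qed (use nonneg in auto)
  then have T1: "T / 2 + 42 * r\<^sup>2 * T + 680 * r ^ 4 * T \<le> S / 4"
    using TS by (simp add: algebra_simps)
  have d: "(Y + 2 * X + 2 * E) / (2 * \<theta>) = Yt / 2 + Xt + Et"
    "(Y + 2 * X + 2 * E) / (16 * \<theta>) = Yt / 16 + Xt / 8 + Et / 8"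
    by (auto simp: t_defs add_divide_distrib)
  show ?thesis
    using f' rX rY rV tE E1 X1 T1 nonneg unfolding d div mult.assoc
    by linarith
qed

section \<open>The potential and the average over one batch\<close>

context cgt
begin

text \<open>All of these have the unit of the objective: squared positions are multiplied, squared
  gradients divided, by a smoothness constant. \<open>SS\<close> keeps the step size of each agent,
  \<open>TT\<close> only the smallest smoothness constant.\<close>

definition "SS s b = (1 / real CARD('m)) * (\<Sum>i\<in>UNIV. \<theta> * L s i * (norm (uu s b i))\<^sup>2)"
definition "XX s = Lm s * dev (iter s)"
definition "YY s b = dev (yy s b) / Lm s"
definition "EE s b = msq (err s b) / Lm s"
definition "TT s b = Lm s * msq (uu s b)"
text \<open>Under \<open>inv\<close> the counter is less than \<open>\<tau> i\<close>, so the
  subtraction is exact and every weight is at least 1.\<close>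

definition "VV s b = (1 / real CARD('m)) *
  (\<Sum>i\<in>UNIV. real (\<tau> i - cnt s i) * (norm (err s b i))\<^sup>2 / L s i)"
text \<open>The batch is an argument besides the state because \<open>y\<close> and \<open>g\<close>
  of an iteration already use the indices drawn in it.\<close>

definition "potential s b = f (avg (iter s)) + 340 / (1 - \<eta>) ^ 3 * XX s + 1 / (1 - \<eta>) * YY s b
  + 17 / (1 - \<eta>)\<^sup>2 * VV s b"
text \<open>The first and last terms, times \<open>32 * \<theta> * Lm s\<close>, give the
  \<open>8 * \<theta> * Lm s\<close> and \<open>2 * Lm s\<close> needed for the gradient map; the
  middle one gives the factor 4/3 of the consensus bound.\<close>

definition "decrease s b = SS s b / 4 + 3 / 4 * XX s + (YY s b + 2 * XX s + 2 * EE s b) / (16 * \<theta>)"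

text \<open>An index is a triple of iteration, agent and position in the batch. Indices are drawn
  for restarting agents too, which ignore them, so the sample space does not depend on the
  run.\<close>

definition idx_pmf :: "nat \<times> 'm \<times> nat \<Rightarrow> nat pmf" where
  "idx_pmf = (\<lambda>(t, i, k). pmf_of_set {1..n i})"
definition idx_set :: "nat \<Rightarrow> (nat \<times> 'm \<times> nat) set" where
  "idx_set t = {(s, i, k). s = t \<and> k < \<tau> i}"

lemma finite_idx_set: "finite (idx_set t)"
proof -
  have "idx_set t = (\<Union>i. (\<lambda>k. (t, i, k)) ` {..<\<tau> i})" by (auto simp: idx_set_def)
  then show ?thesis by simp
qed

lemma finite_idx_pmf: "finite (set_pmf (idx_pmf j))"
proof -
  obtain t i k where "j = (t, i, k)" by (cases j)
  moreover have "{1..n i} \<noteq> {}" using n_pos[of i] by auto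
  ultimately show ?thesis by (simp add: idx_pmf_def)
qed

definition batch_exp :: "nat \<Rightarrow> (('m \<Rightarrow> nat \<Rightarrow> nat) \<Rightarrow> real) \<Rightarrow> real" where
  "batch_exp t h = measure_pmf.expectation (Pi_pmf (idx_set t) undefined idx_pmf)
     (\<lambda>z. h (\<lambda>i k. z (t, i, k)))"

lemma batch_exp_integrable:
  fixes h :: "_ \<Rightarrow> real"
  shows "integrable (measure_pmf (Pi_pmf (idx_set t) undefined idx_pmf)) h"
  by (intro integrable_measure_pmf_finite finite_set_Pi_pmf finite_idx_set finite_idx_pmf)

lemma batch_exp_const [simp]: "batch_exp t (\<lambda>_. c) = c"
  by (simp add: batch_exp_def)

lemma batch_exp_add: "batch_exp t (\<lambda>b. h b + k b) = batch_exp t h + batch_exp t k"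
  unfolding batch_exp_def
  by (intro Bochner_Integration.integral_add batch_exp_integrable)

lemma batch_exp_sum: "batch_exp t (\<lambda>b. \<Sum>i\<in>I. h i b) = (\<Sum>i\<in>I. batch_exp t (h i))"
  unfolding batch_exp_def by (intro Bochner_Integration.integral_sum batch_exp_integrable)

lemma batch_exp_mult: "batch_exp t (\<lambda>b. c * h b) = c * batch_exp t h"
  by (simp add: batch_exp_def)

lemma batch_exp_mono:
  assumes "\<And>b. h b \<le> k b"
  shows "batch_exp t h \<le> batch_exp t k"
  unfolding batch_exp_def using assms
  by (intro expectation_mono_finite finite_set_Pi_pmf finite_idx_set finite_idx_pmf)

lemma batch_exp_mean:
  fixes v :: "nat \<Rightarrow> 'a" and a :: 'a and i :: 'm
  defines "\<mu> \<equiv> (1 / real (n i)) *\<^sub>R (\<Sum>r=1..n i. v r)"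
  shows "batch_exp t (\<lambda>b. (norm (a + (1 / real (\<tau> i)) *\<^sub>R (\<Sum>k<\<tau> i. v (b i k))))\<^sup>2)
    = (norm (a + \<mu>))\<^sup>2 + ((1 / real (n i)) * (\<Sum>r=1..n i. (norm (v r))\<^sup>2) - (norm \<mu>)\<^sup>2) / real (\<tau> i)"
proof -
  let ?S = "(\<lambda>k. (t, i, k)) ` {..<\<tau> i}"
  have inj: "inj_on (\<lambda>k. (t, i, k)) {..<\<tau> i}" by (auto simp: inj_on_def)
  have "measure_pmf.expectation (Pi_pmf (idx_set t) undefined idx_pmf)
      (\<lambda>z. (norm (a + (1 / real (card ?S)) *\<^sub>R (\<Sum>j\<in>?S. v (z j))))\<^sup>2)
    = (norm (a + \<mu>))\<^sup>2
      + ((1 / real (n i)) * (\<Sum>r=1..n i. (norm (v r))\<^sup>2) - (norm \<mu>)\<^sup>2) / real (card ?S)"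
    unfolding \<mu>_def
    using \<tau>_pos[of i] n_pos[of i]
    by (intro expectation_batch_mean finite_idx_set finite_idx_pmf)
      (auto simp: idx_set_def idx_pmf_def lessThan_empty_iff)
  then show ?thesis
    by (simp add: batch_exp_def card_image[OF inj] sum.reindex[OF inj])
qed

section \<open>Pathwise estimates for one iteration\<close>

context
  fixes s :: "('m, 'a) cgt_state" and b :: "'m \<Rightarrow> nat \<Rightarrow> nat"
  assumes inv: "inv s"
begin

lemma Lm_pos: "Lm s > 0"
  using Lm_ge1[OF inv] by simp

lemma quantities_nonneg: "XX s \<ge> 0" "YY s b \<ge> 0" "EE s b \<ge> 0" "TT s b \<ge> 0" "VV s b \<ge> 0"
  using Lm_pos order_trans[OF zero_le_one L_ge1[OF inv]]
  by (auto simp: XX_def YY_def EE_def TT_def VV_def dev_nonneg msq_nonneg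
      intro!: sum_nonneg divide_nonneg_nonneg)

lemma \<theta>_TT_le: "\<theta> * TT s b \<le> SS s b"
proof -
  have "\<theta> * TT s b = (1 / real CARD('m)) * (\<Sum>i\<in>UNIV. \<theta> * Lm s * (norm (uu s b i))\<^sup>2)"
    by (simp add: TT_def msq_def sum_distrib_left algebra_simps)
  also have "\<dots> \<le> SS s b"
    unfolding SS_def using \<theta>_pos Lm_le
    by (intro mult_left_mono sum_mono mult_right_mono) auto
  finally show ?thesis .
qed

text \<open>The error splits into the deviation of \<open>y\<close> and the error of its average.
  The latter equals that of the average of \<open>g\<close>, made up of the estimation errors and of
  the distance of the iterates from their average.\<close>

lemma tracking_error: "msq (\<lambda>i. yy s b i - grad f (avg (iter s)))
  \<le> Lm s * (YY s b + 2 * XX s + 2 * EE s b)"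
proof -
  let ?x = "avg (iter s)"
  let ?d = "\<lambda>i. grad (fl i) (iter s i) - grad (fl i) ?x"
  have "avg (yy s b) - grad f ?x = avg (\<lambda>i. gr s b i - grad (fl i) ?x)"
    by (simp add: avg_y_eq_avg_g[OF inv] grad_global avg_diff)
  also have "\<dots> = avg (err s b) + avg ?d"
    unfolding avg_add[symmetric] by (simp add: err_def)
  finally have "(norm (avg (yy s b) - grad f ?x))\<^sup>2
      \<le> 2 * (norm (avg (err s b)))\<^sup>2 + 2 * (norm (avg ?d))\<^sup>2"
    by (simp only: norm_add_sq_le_double)
  also have "(norm (avg (err s b)))\<^sup>2 \<le> msq (err s b)" by (rule norm_avg_sq_le)
  also have "(norm (avg ?d))\<^sup>2 \<le> msq ?d" by (rule norm_avg_sq_le)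
  also have "msq ?d \<le> msq (\<lambda>i. Lm s *\<^sub>R (iter s i - ?x))"
    using local_lip[OF inv near(1)[OF inv] near(3)[OF inv]]
    by (intro msq_mono) (simp add: power_mult_distrib)
  also have "\<dots> = (Lm s)\<^sup>2 * dev (iter s)" by (simp add: msq_scaleR dev_def)
  finally have "(norm (avg (yy s b) - grad f ?x))\<^sup>2
      \<le> 2 * msq (err s b) + 2 * ((Lm s)\<^sup>2 * dev (iter s))" by simp
  moreover have "Lm s * (YY s b + 2 * XX s + 2 * EE s b)
      = dev (yy s b) + 2 * ((Lm s)\<^sup>2 * dev (iter s)) + 2 * msq (err s b)"
    using Lm_pos by (simp add: XX_def YY_def EE_def distrib_left power2_eq_square)
  ultimately show ?thesis unfolding msq_diff_const by simp
qed

text \<open>Each update is split as the inner product with \<open>y\<close> minus that with the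
  tracking error. Young's inequality at the agent's own step size spends half of the gain from
  \<open>inner_clip_ge\<close> on the tracking error, whether or not clipping is active.\<close>

lemma descent_step: "f (avg (iter (step b s)))
  \<le> f (avg (iter s)) - SS s b / 2 + TT s b / 2 + (YY s b + 2 * XX s + 2 * EE s b) / (2 * \<theta>)"
proof -
  let ?x = "avg (iter s)" and ?x' = "avg (iter (step b s))"
  let ?D = "grad f ?x"
  have dx: "?x' - ?x = - avg (uu s b)"
    by (simp add: iter_step[abs_def] avg_diff avg_mix[OF W_col])
  have "- (?D \<bullet> uu s b i) \<le> (norm (yy s b i - ?D))\<^sup>2 / (2 * \<theta> * Lm s)
      - \<theta> * L s i * (norm (uu s b i))\<^sup>2 / 2" for i
  proof -
    have \<beta>: "\<theta> * L s i > 0" using \<theta>_pos L_ge1[OF inv, of i] by simp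
    have "(yy s b i - ?D) \<bullet> uu s b i
        \<le> (norm (yy s b i - ?D))\<^sup>2 / (2 * (\<theta> * L s i)) + \<theta> * L s i / 2 * (norm (uu s b i))\<^sup>2"
      using \<beta> by (rule young_inner)
    moreover have "(norm (yy s b i - ?D))\<^sup>2 / (2 * (\<theta> * L s i))
        \<le> (norm (yy s b i - ?D))\<^sup>2 / (2 * \<theta> * Lm s)"
      using \<theta>_pos Lm_pos Lm_le[of s i] by (intro divide_left_mono) auto
    moreover have "\<theta> * L s i * (norm (uu s b i))\<^sup>2 \<le> yy s b i \<bullet> uu s b i"
      unfolding uu_def using \<beta> \<delta>_pos by (rule inner_clip_ge)
    ultimately show ?thesis by (simp add: inner_diff_left)
  qed
  then have "(\<Sum>i\<in>UNIV. - (?D \<bullet> uu s b i)) \<le> (\<Sum>i\<in>UNIV. (norm (yy s b i - ?D))\<^sup>2 / (2 * \<theta> * Lm s)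
      - \<theta> * L s i * (norm (uu s b i))\<^sup>2 / 2)"
    by (rule sum_mono)
  then have "(1 / real CARD('m)) * (\<Sum>i\<in>UNIV. - (?D \<bullet> uu s b i))
      \<le> (1 / real CARD('m)) * (\<Sum>i\<in>UNIV. (norm (yy s b i - ?D))\<^sup>2 / (2 * \<theta> * Lm s)
        - \<theta> * L s i * (norm (uu s b i))\<^sup>2 / 2)"
    by (rule mult_left_mono) auto
  also have "\<dots> = msq (\<lambda>i. yy s b i - ?D) / (2 * \<theta> * Lm s) - SS s b / 2"
    by (simp add: msq_def SS_def sum_subtractf sum_divide_distrib[symmetric] diff_divide_distrib
        mult.commute)
  finally have 1: "(?x' - ?x) \<bullet> ?D \<le> msq (\<lambda>i. yy s b i - ?D) / (2 * \<theta> * Lm s) - SS s b / 2"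
    unfolding dx by (simp add: inner_commute[of "avg _"] inner_avg sum_negf)
  have "msq (\<lambda>i. yy s b i - ?D) / (2 * \<theta> * Lm s)
      \<le> Lm s * (YY s b + 2 * XX s + 2 * EE s b) / (2 * \<theta> * Lm s)"
    using \<theta>_pos Lm_pos by (intro divide_right_mono tracking_error) auto
  also have "\<dots> = (YY s b + 2 * XX s + 2 * EE s b) / (2 * \<theta>)" using Lm_pos by simp
  finally have 2: "msq (\<lambda>i. yy s b i - ?D) / (2 * \<theta> * Lm s)
      \<le> (YY s b + 2 * XX s + 2 * EE s b) / (2 * \<theta>)" .
  have "Lm s / 2 * (norm (?x' - ?x))\<^sup>2 \<le> Lm s / 2 * msq (uu s b)"
    unfolding dx using norm_avg_sq_le[of "uu s b"] Lm_pos by (intro mult_left_mono) auto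
  then have 3: "Lm s / 2 * (norm (?x' - ?x))\<^sup>2 \<le> TT s b / 2" by (simp add: TT_def)
  have "f ?x' \<le> f ?x + (?x' - ?x) \<bullet> ?D + Lm s / 2 * (norm (?x' - ?x))\<^sup>2"
    using global_lip[OF inv _ near(3)[OF inv]] near[OF inv]
    by (intro descent_lemma[OF global_differentiable convex_near[OF inv]]) auto
  with 1 2 3 show ?thesis by linarith
qed

text \<open>Every single agent's clipped update bounds the gradient map up to its tracking error.
  The left side is the same for all agents, so averaging the bounds loses nothing on that
  side.\<close>

lemma norm_grad_map_sq_le:
  "(norm (grad_map n F LL \<delta> \<theta> r0 s))\<^sup>2 \<le> 32 * \<theta> * Lm s * decrease s b"
proof -
  let ?D = "grad f (avg (iter s))"
  define G where "G = (norm (grad_map n F LL \<delta> \<theta> r0 s))\<^sup>2"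
  have "G \<le> 8 * (\<theta> * Lm s) * (\<theta> * L s i * (norm (uu s b i))\<^sup>2) + 2 * (norm (yy s b i - ?D))\<^sup>2" for i
    unfolding G_def grad_map_def Let_def uu_def
    using \<theta>_pos Lm_pos Lm_le[of s i] L_le_Lm[OF inv, of i] \<delta>_pos
    by (intro norm_scaled_clip_sq_le) auto
  then have "(\<Sum>i::'m\<in>UNIV. G) \<le> (\<Sum>i\<in>UNIV. 8 * (\<theta> * Lm s) * (\<theta> * L s i * (norm (uu s b i))\<^sup>2)
      + 2 * (norm (yy s b i - ?D))\<^sup>2)"
    by (intro sum_mono)
  then have "(1 / real CARD('m)) * (\<Sum>i::'m\<in>UNIV. G)
      \<le> (1 / real CARD('m)) * (\<Sum>i\<in>UNIV. 8 * (\<theta> * Lm s) * (\<theta> * L s i * (norm (uu s b i))\<^sup>2)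
      + 2 * (norm (yy s b i - ?D))\<^sup>2)"
    by (rule mult_left_mono) auto
  also have "\<dots> = 8 * (\<theta> * Lm s) * SS s b + 2 * msq (\<lambda>i. yy s b i - ?D)"
    unfolding sum.distrib sum_distrib_left[symmetric] by (simp add: SS_def msq_def algebra_simps)
  also have "\<dots> \<le> 8 * (\<theta> * Lm s) * SS s b + 2 * (Lm s * (YY s b + 2 * XX s + 2 * EE s b))"
    using tracking_error by simp
  also have "\<dots> \<le> 32 * \<theta> * Lm s * (SS s b / 4 + (YY s b + 2 * XX s + 2 * EE s b) / (16 * \<theta>))"
    using \<theta>_pos by (simp add: field_simps)
  also have "\<dots> \<le> 32 * \<theta> * Lm s * decrease s b"
    using \<theta>_pos Lm_pos quantities_nonneg by (intro mult_left_mono) (auto simp: decrease_def)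
  finally show ?thesis by (simp add: G_def)
qed

lemma decrease_nonneg: "decrease s b \<ge> 0"
proof -
  have "0 \<le> \<theta> * TT s b" using \<theta>_pos quantities_nonneg by simp
  then have "SS s b \<ge> 0" using \<theta>_TT_le by linarith
  then show ?thesis unfolding decrease_def using \<theta>_pos quantities_nonneg by simp
qed

lemma consensus_le_decrease:
  "(1 / real CARD('m)) * (norm (iter s i - avg (iter s)))\<^sup>2 \<le> 4 / 3 * decrease s b"
proof -
  have "(1 / real CARD('m)) * (norm (iter s i - avg (iter s)))\<^sup>2 \<le> dev (iter s)"
    using norm_sq_le_msq[of "\<lambda>i. iter s i - avg (iter s)" i] by (simp add: dev_def field_simps)
  \<comment> \<open>Removing the weight uses \<open>Lm s \<ge> 1\<close>.\<close>
  also have "\<dots> \<le> XX s"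
    unfolding XX_def using Lm_ge1[OF inv] dev_nonneg[of "iter s"] mult_right_mono[of 1 "Lm s"] by simp
  also have "\<dots> \<le> 4 / 3 * decrease s b"
  proof -
    have "0 \<le> \<theta> * TT s b" using \<theta>_pos quantities_nonneg by simp
    then have "SS s b \<ge> 0" using \<theta>_TT_le by linarith
    moreover define Z where "Z = (YY s b + 2 * XX s + 2 * EE s b) / (16 * \<theta>)"
    have "Z \<ge> 0" unfolding Z_def using \<theta>_pos quantities_nonneg by simp
    moreover have "decrease s b = SS s b / 4 + 3 / 4 * XX s + Z"
      by (simp add: decrease_def Z_def)
    ultimately show ?thesis by simp
  qed
  finally show ?thesis .
qed

lemma potential_ge: "f (avg (iter s)) \<le> potential s b"
  unfolding potential_def using quantities_nonneg \<eta> by simp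

lemma XX_step: "XX (step b s) \<le> (1 - (1 - \<eta>) / 2) * XX s + 2 / (1 - \<eta>) * TT s b"
proof -
  have "iter (step b s) = (\<lambda>i. mix W (iter s) i + - uu s b i)" by (simp add: iter_step fun_eq_iff)
  then have "dev (iter (step b s)) \<le> \<eta> * dev (iter s) + msq (\<lambda>i. - uu s b i) / (1 - \<eta>)"
    using dev_mix_add_le[OF W_row W_col W_norm \<eta>, of "iter s" "\<lambda>i. - uu s b i"] by simp
  also have "msq (\<lambda>i. - uu s b i) = msq (uu s b)" by (simp add: msq_def)
  finally have "XX (step b s) \<le> (\<gamma> * Lm s) * (\<eta> * dev (iter s) + msq (uu s b) / (1 - \<eta>))"
    unfolding XX_def using Lm_step_le[OF inv, of b] \<gamma>_bounds Lm_pos \<eta>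
    by (intro mult_mono) (auto simp: dev_nonneg msq_nonneg)
  also have "\<dots> = (\<gamma> * \<eta>) * XX s + \<gamma> / (1 - \<eta>) * TT s b"
    by (simp add: XX_def TT_def algebra_simps)
  also have "\<dots> \<le> (1 - (1 - \<eta>) / 2) * XX s + 2 / (1 - \<eta>) * TT s b"
    using \<gamma>_bounds \<eta> quantities_nonneg by (intro add_mono mult_right_mono divide_right_mono) auto
  finally show ?thesis .
qed

text \<open>The second batch \<open>b'\<close> belongs to the next iteration: the perturbation of
  \<open>y\<close> is the change of the gradient estimates between the two iterations.\<close>

lemma YY_step: "YY (step b s) b' \<le> (1 - (1 - \<eta>) / 2) * YY s b
  + 2 / ((1 - \<eta>) * Lm s) * msq (\<lambda>i. gr (step b s) b' i - gr s b i)"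
proof -
  let ?d = "msq (\<lambda>i. gr (step b s) b' i - gr s b i)"
  have "yy (step b s) b' = (\<lambda>i. mix W (yy s b) i + (gr (step b s) b' i - gr s b i))"
    by (simp add: cur_y_def[of _ _ _ _ "step b s"] prev_step mix_def fun_eq_iff)
  then have "dev (yy (step b s) b') \<le> \<eta> * dev (yy s b) + ?d / (1 - \<eta>)"
    using dev_mix_add_le[OF W_row W_col W_norm \<eta>, of "yy s b"] by simp
  moreover have "1 / Lm (step b s) \<le> \<gamma> / Lm s"
    using Lm_le_step[OF inv, of b] Lm_pos Lm_ge1[OF inv_step[OF inv], of b] by (simp add: field_simps)
  ultimately have "dev (yy (step b s) b') * (1 / Lm (step b s))
      \<le> (\<eta> * dev (yy s b) + ?d / (1 - \<eta>)) * (\<gamma> / Lm s)"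
    using \<eta> Lm_ge1[OF inv_step[OF inv], of b]
    by (intro mult_mono) (auto simp: dev_nonneg msq_nonneg)
  also have "\<dots> = (\<gamma> * \<eta>) * YY s b + \<gamma> / ((1 - \<eta>) * Lm s) * ?d"
    by (simp add: YY_def algebra_simps)
  also have "\<dots> \<le> (1 - (1 - \<eta>) / 2) * YY s b + 2 / ((1 - \<eta>) * Lm s) * ?d"
    using \<gamma>_bounds \<eta> quantities_nonneg Lm_pos
    by (intro add_mono mult_right_mono divide_right_mono) (auto simp: msq_nonneg)
  finally show ?thesis by (simp add: YY_def)
qed

lemma movement: "Lm s * msq (\<lambda>i. iter (step b s) i - iter s i) \<le> 8 * XX s + 2 * TT s b"
proof -
  have "msq (\<lambda>i. iter (step b s) i - iter s i) = msq (\<lambda>i. (mix W (iter s) i - iter s i) - uu s b i)"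
    by (simp add: iter_step algebra_simps)
  also have "\<dots> \<le> 2 * msq (\<lambda>i. mix W (iter s) i - iter s i) + 2 * msq (uu s b)"
    by (rule msq_diff_le_double)
  also have "\<dots> \<le> 2 * (4 * dev (iter s)) + 2 * msq (uu s b)"
    using msq_mix_diff_le[OF W_row W_col W_norm \<eta>, of "iter s"] by simp
  finally have "Lm s * msq (\<lambda>i. iter (step b s) i - iter s i)
      \<le> Lm s * (2 * (4 * dev (iter s)) + 2 * msq (uu s b))"
    using Lm_pos by (intro mult_left_mono) auto
  then show ?thesis by (simp add: XX_def TT_def algebra_simps)
qed

end

end


section \<open>Averages over the next batch\<close>

context cgt
begin

context
  fixes s :: "('m, 'a) cgt_state" and b :: "'m \<Rightarrow> nat \<Rightarrow> nat"
  assumes inv: "inv s"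
begin

definition "incr i r = grad (F i r) (iter (step b s) i) - grad (F i r) (iter s i)"

lemma gr_step: "gr (step b s) b' i =
  (if flag (step b s) i then grad (fl i) (iter (step b s) i)
   else gr s b i + (1 / real (\<tau> i)) *\<^sub>R (\<Sum>k<\<tau> i. incr i (b' i k)))"
  by (simp add: cur_g_def[of _ _ _ "step b s"] prev_step incr_def)

lemma mean_incr: "(1 / real (n i)) *\<^sub>R (\<Sum>r=1..n i. incr i r)
  = grad (fl i) (iter (step b s) i) - grad (fl i) (iter s i)"
  by (simp add: incr_def grad_local sum_subtractf scaleR_diff_right)

lemma mean_incr_sq: "(1 / real (n i)) * (\<Sum>r=1..n i. (norm (incr i r))\<^sup>2)
  \<le> (Lm s)\<^sup>2 * (norm (iter (step b s) i - iter s i))\<^sup>2"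
  unfolding incr_def by (rule component_lip[OF inv near(2)[OF inv] near(1)[OF inv]])

text \<open>A restart replaces the estimate by the exact gradient and so releases the accumulated
  error into the increment. Inside an epoch the increment is a batch mean, whose second moment is at
  most the mean square of the component increments.\<close>

lemma batch_exp_gr_diff: "batch_exp t (\<lambda>b'. (norm (gr (step b s) b' i - gr s b i))\<^sup>2)
  \<le> 2 * (norm (err s b i))\<^sup>2 + 2 * ((Lm s)\<^sup>2 * (norm (iter (step b s) i - iter s i))\<^sup>2)"
proof (cases "flag (step b s) i")
  case True
  let ?d = "grad (fl i) (iter (step b s) i) - grad (fl i) (iter s i)"
  have "gr (step b s) b' i - gr s b i = - err s b i + ?d" for b'
    using True by (simp add: gr_step err_def)
  then have "batch_exp t (\<lambda>b'. (norm (gr (step b s) b' i - gr s b i))\<^sup>2) = (norm (- err s b i + ?d))\<^sup>2"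
    by simp
  also have "\<dots> \<le> 2 * (norm (- err s b i))\<^sup>2 + 2 * (norm ?d)\<^sup>2"
    by (rule norm_add_sq_le_double)
  finally show ?thesis
    using local_lip[OF inv near(2)[OF inv] near(1)[OF inv], of i b i i] by simp
next
  case False
  let ?\<mu> = "(1 / real (n i)) *\<^sub>R (\<Sum>r=1..n i. incr i r)"
  let ?Q = "(1 / real (n i)) * (\<Sum>r=1..n i. (norm (incr i r))\<^sup>2)"
  have "{1..n i} \<noteq> {}" using n_pos[of i] by auto
  then have \<mu>Q: "(norm ?\<mu>)\<^sup>2 \<le> ?Q"
    using norm_sq_mean_le[of "{1..n i}" "incr i"] by simp
  have "batch_exp t (\<lambda>b'. (norm (gr (step b s) b' i - gr s b i))\<^sup>2)
      = batch_exp t (\<lambda>b'. (norm (0 + (1 / real (\<tau> i)) *\<^sub>R (\<Sum>k<\<tau> i. incr i (b' i k))))\<^sup>2)"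
    using False by (simp add: gr_step)
  also have "\<dots> = (norm (0 + ?\<mu>))\<^sup>2 + (?Q - (norm ?\<mu>)\<^sup>2) / real (\<tau> i)"
    by (rule batch_exp_mean)
  also have "\<dots> \<le> (norm ?\<mu>)\<^sup>2 + (?Q - (norm ?\<mu>)\<^sup>2) / 1"
    using \<tau>_pos[of i] \<mu>Q by (intro add_mono divide_left_mono) auto
  also have "\<dots> \<le> (Lm s)\<^sup>2 * (norm (iter (step b s) i - iter s i))\<^sup>2"
    using mean_incr_sq[of i] by simp
  also have "\<dots> \<le> 2 * ((Lm s)\<^sup>2 * (norm (iter (step b s) i - iter s i))\<^sup>2)" by simp
  finally show ?thesis using zero_le_power2[of "norm (err s b i)"] by linarith
qed

text \<open>At a restart the error vanishes, and a weight of at least 1 is released. Inside an epoch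
  the counter advances, which releases exactly one unit of weight, while the fresh variance carries
  \<open>1 / \<tau> i\<close> and meets a weight of at most \<open>\<tau> i\<close>. A unit of
  weight is worth a quarter on the scale \<open>Lm s\<close>, since
  \<open>L s i \<le> 4 * Lm s\<close>.\<close>

lemma batch_exp_err:
  "batch_exp t (\<lambda>b'. real (\<tau> i - cnt (step b s) i) * (norm (err (step b s) b' i))\<^sup>2 / L (step b s) i)
    \<le> real (\<tau> i - cnt s i) * (norm (err s b i))\<^sup>2 / L s i - (norm (err s b i))\<^sup>2 / (4 * Lm s)
      + Lm s * (norm (iter (step b s) i - iter s i))\<^sup>2"
proof -
  let ?e = "(norm (err s b i))\<^sup>2" and ?m = "(norm (iter (step b s) i - iter s i))\<^sup>2"
  have Lp: "L s i > 0" "Lm s > 0" using L_ge1[OF inv, of i] Lm_pos[OF inv] by auto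
  have e4: "?e / (4 * Lm s) \<le> ?e / L s i"
    using L_le_Lm[OF inv, of i] Lp by (intro divide_left_mono) auto
  have c: "real (\<tau> i - cnt s i) \<ge> 1" using cnt_less[OF inv, of i] by simp
  show ?thesis
  proof (cases "flag (step b s) i")
    case True
    then have "err (step b s) b' i = 0" for b' by (simp add: gr_step err_def[of "step b s"])
    moreover have "?e / L s i \<le> real (\<tau> i - cnt s i) * ?e / L s i"
      using c Lp mult_right_mono[of 1 "real (\<tau> i - cnt s i)" ?e]
      by (intro divide_right_mono) auto
    moreover have "Lm s * ?m \<ge> 0" using Lp by simp
    ultimately show ?thesis using e4 by simp
  next
    case False
    let ?\<mu> = "(1 / real (n i)) *\<^sub>R (\<Sum>r=1..n i. incr i r)"
    let ?Q = "(1 / real (n i)) * (\<Sum>r=1..n i. (norm (incr i r))\<^sup>2)"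
    define c' where "c' = real (\<tau> i - cnt (step b s) i)"
    have c': "c' = real (\<tau> i - cnt s i) - 1" "0 \<le> c'" "c' \<le> real (\<tau> i)"
      using False cnt_less[OF inv, of i]
      by (auto simp: c'_def cnt_def[of "step b s"] counter_step)
    have L': "L (step b s) i = L s i" using False by (simp add: cur_L_def[of _ _ "step b s"] prev_step)
    \<comment> \<open>The mean increment equals the change of the exact gradient, so the new error
      has the old error as its conditional mean.\<close>
    have "err (step b s) b' i
        = (err s b i - ?\<mu>) + (1 / real (\<tau> i)) *\<^sub>R (\<Sum>k<\<tau> i. incr i (b' i k))" for b'
      unfolding mean_incr using False by (simp add: err_def gr_step)
    then have "batch_exp t (\<lambda>b'. (norm (err (step b s) b' i))\<^sup>2)
        = (norm ((err s b i - ?\<mu>) + ?\<mu>))\<^sup>2 + (?Q - (norm ?\<mu>)\<^sup>2) / real (\<tau> i)"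
      by (simp only: batch_exp_mean)
    also have "\<dots> \<le> ?e + (Lm s)\<^sup>2 * ?m / real (\<tau> i)"
    proof -
      have "?Q - (norm ?\<mu>)\<^sup>2 \<le> (Lm s)\<^sup>2 * ?m"
        using mean_incr_sq[of i] zero_le_power2[of "norm ?\<mu>"] by linarith
      then show ?thesis
        unfolding diff_add_cancel by (intro add_left_mono divide_right_mono) simp_all
    qed
    finally have "c' / L s i * batch_exp t (\<lambda>b'. (norm (err (step b s) b' i))\<^sup>2)
        \<le> c' / L s i * (?e + (Lm s)\<^sup>2 * ?m / real (\<tau> i))"
      using c' Lp by (intro mult_left_mono) auto
    also have "\<dots> = c' * ?e / L s i + (c' / real (\<tau> i)) * ((Lm s / L s i) * (Lm s * ?m))"
      by (simp add: algebra_simps power2_eq_square)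
    also have "(c' / real (\<tau> i)) * ((Lm s / L s i) * (Lm s * ?m)) \<le> 1 * (1 * (Lm s * ?m))"
      using c' Lp Lm_le[of s i] \<tau>_pos[of i] by (intro mult_mono) (auto simp: divide_le_eq_1)
    also have "c' * ?e / L s i = real (\<tau> i - cnt s i) * ?e / L s i - ?e / L s i"
      by (simp add: c' left_diff_distrib diff_divide_distrib)
    finally have "c' / L s i * batch_exp t (\<lambda>b'. (norm (err (step b s) b' i))\<^sup>2)
        \<le> real (\<tau> i - cnt s i) * ?e / L s i - ?e / (4 * Lm s) + Lm s * ?m"
      using e4 by simp
    then show ?thesis
      by (simp add: batch_exp_mult[symmetric] L' flip: c'_def)
  qed
qed

lemma batch_exp_VV: "batch_exp t (VV (step b s))
  \<le> VV s b - EE s b / 4 + (8 * XX s + 2 * TT s b)"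
proof -
  let ?m = "msq (\<lambda>i. iter (step b s) i - iter s i)"
  have "batch_exp t (VV (step b s)) = (1 / real CARD('m)) * (\<Sum>i\<in>UNIV. batch_exp t (\<lambda>b'.
      real (\<tau> i - cnt (step b s) i) * (norm (err (step b s) b' i))\<^sup>2 / L (step b s) i))"
    unfolding VV_def[abs_def] batch_exp_mult batch_exp_sum ..
  also have "\<dots> \<le> (1 / real CARD('m)) * (\<Sum>i\<in>UNIV. real (\<tau> i - cnt s i) * (norm (err s b i))\<^sup>2 / L s i
      - (norm (err s b i))\<^sup>2 / (4 * Lm s) + Lm s * (norm (iter (step b s) i - iter s i))\<^sup>2)"
    by (intro mult_left_mono sum_mono batch_exp_err) auto
  also have "\<dots> = VV s b - EE s b / 4 + Lm s * ?m"
    unfolding VV_def EE_def msq_def sum.distrib sum_subtractf sum_distrib_left[symmetric]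
      sum_divide_distrib[symmetric]
    by (simp add: distrib_left right_diff_distrib mult.commute)
  finally show ?thesis using movement[OF inv, of b] by linarith
qed

lemma batch_exp_YY: "batch_exp t (YY (step b s)) \<le> (1 - (1 - \<eta>) / 2) * YY s b
  + 4 / (1 - \<eta>) * EE s b + 4 / (1 - \<eta>) * (8 * XX s + 2 * TT s b)"
proof -
  let ?m = "msq (\<lambda>i. iter (step b s) i - iter s i)"
  let ?d = "\<lambda>b'. msq (\<lambda>i. gr (step b s) b' i - gr s b i)"
  have p: "Lm s > 0" "1 - \<eta> > 0" using Lm_pos[OF inv] \<eta> by auto
  have "batch_exp t ?d = (1 / real CARD('m)) *
      (\<Sum>i\<in>UNIV. batch_exp t (\<lambda>b'. (norm (gr (step b s) b' i - gr s b i))\<^sup>2))"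
    unfolding msq_def batch_exp_mult batch_exp_sum ..
  also have "\<dots> \<le> (1 / real CARD('m)) * (\<Sum>i\<in>UNIV. 2 * (norm (err s b i))\<^sup>2
      + 2 * ((Lm s)\<^sup>2 * (norm (iter (step b s) i - iter s i))\<^sup>2))"
    by (intro mult_left_mono sum_mono batch_exp_gr_diff) auto
  also have "\<dots> = 2 * msq (err s b) + 2 * (Lm s)\<^sup>2 * ?m"
    unfolding sum.distrib sum_distrib_left[symmetric] by (simp add: msq_def distrib_left mult_ac)
  finally have d: "batch_exp t ?d \<le> 2 * msq (err s b) + 2 * (Lm s)\<^sup>2 * ?m" .
  have "batch_exp t (YY (step b s))
      \<le> batch_exp t (\<lambda>b'. (1 - (1 - \<eta>) / 2) * YY s b + 2 / ((1 - \<eta>) * Lm s) * ?d b')"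
    by (intro batch_exp_mono YY_step inv)
  also have "\<dots> = (1 - (1 - \<eta>) / 2) * YY s b + 2 / ((1 - \<eta>) * Lm s) * batch_exp t ?d"
    by (simp only: batch_exp_add batch_exp_mult batch_exp_const)
  also have "\<dots> \<le> (1 - (1 - \<eta>) / 2) * YY s b
      + 2 / ((1 - \<eta>) * Lm s) * (2 * msq (err s b) + 2 * (Lm s)\<^sup>2 * ?m)"
    using p d by (intro add_left_mono mult_left_mono) auto
  also have "2 / ((1 - \<eta>) * Lm s) * (2 * msq (err s b) + 2 * (Lm s)\<^sup>2 * ?m)
      = 4 / (1 - \<eta>) * EE s b + 4 / (1 - \<eta>) * (Lm s * ?m)"
  proof -
    have "2 / (q * l) * (2 * a + 2 * l\<^sup>2 * m) = 4 / q * (a / l) + 4 / q * (l * m)"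
      if "q > 0" "l > 0" for q l a m :: real
      using that by (simp add: field_simps power2_eq_square)
    from this[OF p(2,1)] show ?thesis by (simp add: EE_def)
  qed
  also have "4 / (1 - \<eta>) * (Lm s * ?m) \<le> 4 / (1 - \<eta>) * (8 * XX s + 2 * TT s b)"
    using p by (intro mult_left_mono movement inv) auto
  finally show ?thesis by simp
qed

text \<open>Given the present batch, the next iterates are determined; only the \<open>YY\<close>
  and \<open>VV\<close> terms are averaged over the next one.\<close>

lemma batch_exp_potential:
  "batch_exp t (potential (step b s)) \<le> potential s b - decrease s b"
proof -
  have "batch_exp t (potential (step b s)) = f (avg (iter (step b s)))
      + 340 / (1 - \<eta>) ^ 3 * XX (step b s) + 1 / (1 - \<eta>) * batch_exp t (YY (step b s))
      + 17 / (1 - \<eta>)\<^sup>2 * batch_exp t (VV (step b s))"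
    unfolding potential_def[abs_def]
    by (simp only: batch_exp_add batch_exp_mult batch_exp_const)
  also have "\<dots> \<le> potential s b - decrease s b"
    unfolding potential_def decrease_def
    using \<eta>
    by (intro potential_arithmetic[OF _ _ \<theta>_ge quantities_nonneg(1-4)[OF inv]
          \<theta>_TT_le[OF inv] descent_step[OF inv] XX_step[OF inv] batch_exp_YY batch_exp_VV]) auto
  finally show ?thesis .
qed

end

end


subsection \<open>Averaging over the history\<close>

context cgt
begin

text \<open>The state at time \<open>t\<close> is a function of \<open>hist t\<close>, the batch of
  iteration \<open>t\<close> one of \<open>idx_set t\<close>; so the potential at time
  \<open>t\<close> lives on \<open>hist (Suc t)\<close>.\<close>

definition hist :: "nat \<Rightarrow> (nat \<times> 'm \<times> nat) set" where
  "hist t = {(s, i, k). s < t \<and> k < \<tau> i}"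

definition run :: "'a \<Rightarrow> (nat \<times> 'm \<times> nat \<Rightarrow> nat) \<Rightarrow> nat \<Rightarrow> ('m, 'a) cgt_state" where
  "run x0 z = cgt_run W n F LL \<delta> \<rho> \<theta> r0 \<tau> \<tau> x0 (\<lambda>t i k. z (t, i, k))"

definition batch :: "(nat \<times> 'm \<times> nat \<Rightarrow> nat) \<Rightarrow> nat \<Rightarrow> 'm \<Rightarrow> nat \<Rightarrow> nat" where
  "batch z t = (\<lambda>i k. z (t, i, k))"

lemma run_0 [simp]: "run x0 z 0 = init_state x0"
  and run_Suc: "run x0 z (Suc t) = step (batch z t) (run x0 z t)"
  by (simp_all add: run_def batch_def)

lemma hist_Suc: "hist (Suc t) = hist t \<union> idx_set t" and hist_disjoint: "hist t \<inter> idx_set t = {}"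
  by (auto simp: hist_def idx_set_def less_Suc_eq)

lemma finite_hist: "finite (hist t)"
proof (induction t)
  case 0
  have "hist 0 = {}" by (simp add: hist_def)
  then show ?case by simp
qed (simp add: hist_Suc finite_idx_set)

lemma gr_cong:
  assumes "\<And>i k. k < \<tau> i \<Longrightarrow> b i k = b' i k"
  shows "gr s b = gr s b'"
  using assms by (auto simp: cur_g_def fun_eq_iff intro!: sum.cong)

lemma step_cong:
  assumes "\<And>i k. k < \<tau> i \<Longrightarrow> b i k = b' i k"
  shows "step b s = step b' s"
proof -
  have "gr s b = gr s b'" by (intro gr_cong assms)
  moreover from this have "yy s b = yy s b'" by (simp add: cur_y_def fun_eq_iff)
  ultimately show ?thesis by (simp add: cgt_step_def)
qed

lemma decrease_cong:
  assumes "\<And>i k. k < \<tau> i \<Longrightarrow> b i k = b' i k"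
  shows "decrease s b = decrease s b'"
proof -
  have g: "gr s b = gr s b'" by (intro gr_cong assms)
  moreover from g have y: "yy s b = yy s b'" by (simp add: cur_y_def fun_eq_iff)
  moreover from y have "uu s b = uu s b'" by (simp add: uu_def fun_eq_iff)
  moreover from g have "err s b = err s b'" by (simp add: err_def fun_eq_iff)
  ultimately show ?thesis by (simp add: decrease_def SS_def YY_def EE_def)
qed

text \<open>Adaptedness of the run, in place of a filtration.\<close>

lemma run_cong:
  assumes "\<And>j. j \<in> hist t \<Longrightarrow> z j = z' j"
  shows "run x0 z t = run x0 z' t"
  using assms
proof (induction t)
  case (Suc t)
  then have "run x0 z t = run x0 z' t" by (simp add: hist_Suc)
  moreover have "step (batch z t) s = step (batch z' t) s" for s
    using Suc.prems by (intro step_cong) (auto simp: batch_def hist_def)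
  ultimately show ?case by (simp add: run_Suc)
qed simp

lemma inv_run: "inv (run x0 z t)"
  by (induction t) (simp_all add: inv_init run_Suc inv_step)

definition hist_exp :: "nat \<Rightarrow> ((nat \<times> 'm \<times> nat \<Rightarrow> nat) \<Rightarrow> real) \<Rightarrow> real" where
  "hist_exp t h = measure_pmf.expectation (Pi_pmf (hist t) undefined idx_pmf) h"

lemma hist_exp_mono:
  assumes "\<And>z. h z \<le> k z"
  shows "hist_exp t h \<le> hist_exp t k"
  unfolding hist_exp_def using assms
  by (intro expectation_mono_finite finite_set_Pi_pmf finite_hist finite_idx_pmf)

lemma hist_exp_diff: "hist_exp t (\<lambda>z. h z - k z) = hist_exp t h - hist_exp t k"
  unfolding hist_exp_def
  by (intro Bochner_Integration.integral_diff integrable_measure_pmf_finite finite_set_Pi_pmf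
      finite_hist finite_idx_pmf)

lemma hist_exp_const [simp]: "hist_exp t (\<lambda>_. c) = c"
  by (simp add: hist_exp_def)

definition mean_decrease :: "'a \<Rightarrow> nat \<Rightarrow> real" where
  "mean_decrease x0 t = hist_exp (Suc t) (\<lambda>z. decrease (run x0 z t) (batch z t))"

text \<open>The tower property over the split of the history into the past and the newest batch: the
  state depends on the past alone, so the inner average is a \<open>batch_exp\<close>.\<close>

lemma potential_mean_step:
  "hist_exp (Suc (Suc t)) (\<lambda>z. potential (run x0 z (Suc t)) (batch z (Suc t)))
    \<le> hist_exp (Suc t) (\<lambda>z. potential (run x0 z t) (batch z t)) - mean_decrease x0 t"
proof -
  let ?h = "\<lambda>z. potential (run x0 z (Suc t)) (batch z (Suc t))"
  have "hist_exp (Suc (Suc t)) ?h = hist_exp (Suc t) (\<lambda>z. measure_pmf.expectation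
      (Pi_pmf (idx_set (Suc t)) undefined idx_pmf)
      (\<lambda>g. ?h (\<lambda>j. if j \<in> hist (Suc t) then z j else g j)))"
    unfolding hist_exp_def hist_Suc[of "Suc t"]
    by (intro expectation_Pi_pmf_union finite_hist finite_idx_set hist_disjoint finite_idx_pmf)
  also have "\<dots> = hist_exp (Suc t)
      (\<lambda>z. batch_exp (Suc t) (potential (step (batch z t) (run x0 z t))))"
  proof -
    have "run x0 (\<lambda>j. if j \<in> hist (Suc t) then z j else g j) (Suc t) = run x0 z (Suc t)" for z g
      by (intro run_cong) simp
    moreover have "batch (\<lambda>j. if j \<in> hist (Suc t) then z j else g j) (Suc t)
        = (\<lambda>i k. g (Suc t, i, k))" for z g
      by (simp add: batch_def hist_def)
    ultimately show ?thesis by (simp add: batch_exp_def run_Suc)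
  qed
  also have "\<dots> \<le> hist_exp (Suc t) (\<lambda>z. potential (run x0 z t) (batch z t)
      - decrease (run x0 z t) (batch z t))"
    by (intro hist_exp_mono batch_exp_potential inv_run)
  finally show ?thesis by (simp add: hist_exp_diff mean_decrease_def)
qed

text \<open>All agents start at one point with exact gradients, so only \<open>YY\<close> survives
  besides the objective. There \<open>y\<close> consists of the local gradients at
  \<open>x0\<close>, and its deviation is the sum in \<open>Delta_f\<close>.\<close>

lemma potential_init: "potential (init_state x0) b \<le> (INF x. f x) + Delta_f n F LL r0 \<eta> x0"
proof -
  let ?s = "init_state x0 :: ('m, 'a) cgt_state"
  let ?P = "\<Sum>i\<in>UNIV. (norm (grad f x0 - grad (fl i) x0))\<^sup>2"
  have g: "gr ?s b = (\<lambda>i. grad (fl i) x0)"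
    by (simp add: cur_g_def init_state_def fun_eq_iff)
  then have y: "yy ?s b = (\<lambda>i. grad (fl i) x0)"
    by (simp add: cur_y_def fun_eq_iff) (simp add: init_state_def)
  have "err ?s b = (\<lambda>i. 0)"
    by (simp add: err_def fun_eq_iff g) (simp add: init_state_def)
  then have "VV ?s b = 0" by (simp add: VV_def)
  moreover have "XX ?s = 0" by (simp add: XX_def init_state_def dev_const)
  moreover have "f (avg (iter ?s)) = f x0" by (simp add: init_state_def avg_const)
  moreover have YY: "1 / (1 - \<eta>) * YY ?s b = ?P / (real CARD('m) * (1 - \<eta>) * Lm ?s)"
    by (simp add: YY_def y dev_def grad_global[symmetric] msq_def norm_minus_commute)
  moreover have "?P / (real CARD('m) * (1 - \<eta>) * Lm ?s)
      \<le> 5 * ?P / (2 * real CARD('m) * (1 - \<eta>) * Lm ?s)"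
  proof -
    define Z where "Z = ?P / (real CARD('m) * (1 - \<eta>) * Lm ?s)"
    have "Z \<ge> 0" unfolding Z_def
      using \<eta> Lm_pos[OF inv_init[of x0]] by (intro divide_nonneg_nonneg sum_nonneg) auto
    then have "Z \<le> 5 / 2 * Z" by simp
    also have "5 / 2 * Z = 5 * ?P / (2 * real CARD('m) * (1 - \<eta>) * Lm ?s)"
      by (simp add: Z_def mult.assoc)
    finally show ?thesis by (simp add: Z_def)
  qed
  ultimately show ?thesis
    by (simp add: potential_def Delta_f_def)
qed

lemma sum_mean_decrease: "(\<Sum>t<T. mean_decrease x0 t) \<le> Delta_f n F LL r0 \<eta> x0"
proof -
  let ?A = "\<lambda>t. hist_exp (Suc t) (\<lambda>z. potential (run x0 z t) (batch z t))"
  have "(\<Sum>t<T. mean_decrease x0 t) \<le> ?A 0 - ?A T"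
  proof (induction T)
    case (Suc T)
    then show ?case using potential_mean_step[of T x0] by simp
  qed simp
  moreover have "?A 0 \<le> hist_exp (Suc 0) (\<lambda>_. (INF x. f x) + Delta_f n F LL r0 \<eta> x0)"
    by (intro hist_exp_mono) (simp add: potential_init)
  moreover have "hist_exp (Suc T) (\<lambda>_. INF x. f x) \<le> ?A T"
  proof (intro hist_exp_mono)
    fix z
    have "(INF x. f x) \<le> f (avg (iter (run x0 z T)))" using bdd by (intro cINF_lower) auto
    also have "\<dots> \<le> potential (run x0 z T) (batch z T)" by (intro potential_ge inv_run)
    finally show "(INF x. f x) \<le> potential (run x0 z T) (batch z T)" .
  qed
  ultimately show ?thesis by simp
qed

end

section \<open>Transfer to the given probability space and random output time\<close>

locale cgt_random = cgt n F LL W \<eta> \<gamma> \<delta> \<rho> \<theta> r0 \<tau> + prob_space M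
  for n :: "'m::finite \<Rightarrow> nat" and F :: "'m \<Rightarrow> nat \<Rightarrow> 'a::euclidean_space \<Rightarrow> real"
    and LL W \<eta> \<gamma> \<delta> \<rho> \<theta> r0 \<tau> and M :: "'w measure" +
  fixes x0 :: 'a and \<xi> :: "nat \<times> 'm \<times> nat \<Rightarrow> 'w \<Rightarrow> nat" and tout :: "'w \<Rightarrow> nat" and T :: nat
  assumes indep: "indep_vars (\<lambda>_. count_space UNIV) (case_option tout \<xi>)
      (insert None (Some ` {(t, i, k). k < \<tau> i}))"
    and \<xi>_unif: "\<And>t i k. k < \<tau> i \<Longrightarrow>
      distr M (count_space UNIV) (\<xi> (t, i, k)) = measure_pmf (pmf_of_set {1..n i})"
    and T: "T \<ge> 1"
    and tout_unif: "distr M (count_space UNIV) tout = measure_pmf (pmf_of_set {0..<T})"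
begin

definition "sample \<omega> = (\<lambda>j. \<xi> j \<omega>)"

lemma tout_measurable: "tout \<in> measurable M (count_space UNIV)"
  using indep by (auto simp: indep_vars_def)

text \<open>The value sets of the joint family, in which \<open>None\<close> stands for the output
  time and \<open>Some\<close> marks the samples.\<close>

definition "family_range = case_option {0..<T} (\<lambda>(t :: nat, i, k :: nat). {1..n i})"

lemma family_uniform:
  assumes "j \<in> insert None (Some ` hist t)"
  shows "finite (family_range j) \<and> family_range j \<noteq> {}"
    and "distr M (count_space UNIV) (case_option tout \<xi> j) = measure_pmf (pmf_of_set (family_range j))"
  using assms T n_pos tout_unif \<xi>_unif
  by (auto simp: family_range_def hist_def Suc_le_eq)

lemma family_subset: "insert None (Some ` hist t) \<subseteq> insert None (Some ` {(t, i, k). k < \<tau> i})"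
  by (auto simp: hist_def)

lemma AE_tout: "AE \<omega> in M. tout \<omega> < T"
proof -
  have "AE r in distr M (count_space UNIV) tout. r < T"
    unfolding tout_unif using T by (simp add: AE_measure_pmf_iff)
  then show ?thesis using tout_measurable by (simp add: AE_distr_iff)
qed

lemma expectation_hist:
  fixes h :: "(nat \<times> 'm \<times> nat \<Rightarrow> nat) \<Rightarrow> real"
  assumes cong: "\<And>z z'. (\<And>j. j \<in> hist t \<Longrightarrow> z j = z' j) \<Longrightarrow> h z = h z'"
  shows "integrable M (\<lambda>\<omega>. h (sample \<omega>))" and "expectation (\<lambda>\<omega>. h (sample \<omega>)) = hist_exp t h"
proof -
  have "indep_vars (\<lambda>_. count_space UNIV) (case_option tout \<xi>) (Some ` hist t)"
    using indep by (rule indep_vars_subset) (auto simp: hist_def)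
  then have ind: "indep_vars (\<lambda>_. count_space UNIV) \<xi> (hist t)"
    using indep_vars_reindex[of Some "hist t" "\<lambda>_. count_space UNIV" "case_option tout \<xi>"]
    by simp
  have h: "h (restrict (\<lambda>j. \<xi> j \<omega>) (hist t)) = h (sample \<omega>)" for \<omega>
    by (rule cong) (simp add: sample_def)
  let ?R = "\<lambda>(t :: nat, i, k :: nat). {1..n i}"
  have R: "finite (?R j) \<and> ?R j \<noteq> {}" for j
    using n_pos by (cases j) (auto simp: Suc_le_eq)
  have U: "distr M (count_space UNIV) (\<xi> j) = measure_pmf (pmf_of_set (?R j))" if "j \<in> hist t" for j
    using that \<xi>_unif by (cases j) (auto simp: hist_def)
  show "integrable M (\<lambda>\<omega>. h (sample \<omega>))"
    using expectation_indep_uniform(1)[OF ind finite_hist subset_refl R U, of h] by (simp add: h)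
  show "expectation (\<lambda>\<omega>. h (sample \<omega>)) = hist_exp t h"
    using expectation_indep_uniform(2)[OF ind finite_hist subset_refl R U, of h]
    by (simp add: h hist_exp_def idx_pmf_def case_prod_unfold)
qed

text \<open>The output time is one coordinate of the finite product, and its event splits off with
  probability \<open>1 / T\<close>. The times \<open>t\<close> and \<open>r\<close> are separate
  because the decrease at time \<open>r\<close> depends on \<open>hist (Suc r)\<close>.\<close>

lemma expectation_at_tout:
  fixes h :: "(nat \<times> 'm \<times> nat \<Rightarrow> nat) \<Rightarrow> real"
  assumes cong: "\<And>z z'. (\<And>j. j \<in> hist t \<Longrightarrow> z j = z' j) \<Longrightarrow> h z = h z'" and r: "r < T"
  shows "integrable M (\<lambda>\<omega>. of_bool (tout \<omega> = r) * h (sample \<omega>))"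
    and "expectation (\<lambda>\<omega>. of_bool (tout \<omega> = r) * h (sample \<omega>)) = hist_exp t h / real T"
proof -
  let ?I = "insert None (Some ` hist t)"
  let ?k = "\<lambda>z. h (\<lambda>j. z (Some j))"
  let ?h = "\<lambda>z. of_bool (z None = r) * ?k z"
  let ?Z = "\<lambda>J \<omega>. restrict (\<lambda>j. case_option tout \<xi> j \<omega>) J"
  let ?p = "\<lambda>j. pmf_of_set (family_range j)"
  have hI: "?h (?Z ?I \<omega>) = of_bool (tout \<omega> = r) * h (sample \<omega>)" for \<omega>
  proof -
    have "?k (?Z ?I \<omega>) = h (sample \<omega>)" by (intro cong) (simp add: sample_def)
    then show ?thesis by simp
  qed
  have hS: "?k (?Z (Some ` hist t) \<omega>) = h (sample \<omega>)" for \<omega>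
    by (intro cong) (simp add: sample_def)
  have fin: "finite ?I" "finite (Some ` hist t)" using finite_hist by auto
  have S: "Some ` hist t \<subseteq> insert None (Some ` {(t, i, k). k < \<tau> i})"
    using family_subset by blast
  note U = family_uniform
  show "integrable M (\<lambda>\<omega>. of_bool (tout \<omega> = r) * h (sample \<omega>))"
    using expectation_indep_uniform(1)[OF indep fin(1) family_subset U, where h = ?h]
    by (simp only: hI)
  have finp: "finite (set_pmf (?p j))" if "j \<in> ?I" for j
    using U(1)[OF that] by simp
  have "expectation (\<lambda>\<omega>. of_bool (tout \<omega> = r) * h (sample \<omega>))
      = measure_pmf.expectation (Pi_pmf ?I undefined ?p) ?h"
    using expectation_indep_uniform(2)[OF indep fin(1) family_subset U, where h = ?h]
    by (simp only: hI)
  also have "\<dots> = measure_pmf.expectation (?p None) (\<lambda>y. measure_pmf.expectation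
      (Pi_pmf (Some ` hist t) undefined ?p) (\<lambda>z. ?h (z(None := y))))"
    using fin finp
    by (subst Pi_pmf_insert)
      (auto simp: case_prod_unfold expectation_pair_pmf_finite finite_set_Pi_pmf)
  also have "\<dots> = measure_pmf.expectation (?p None) (\<lambda>y. of_bool (y = r) *
      measure_pmf.expectation (Pi_pmf (Some ` hist t) undefined ?p) ?k)"
    by simp
  also have "measure_pmf.expectation (Pi_pmf (Some ` hist t) undefined ?p) ?k = hist_exp t h"
  proof -
    have "expectation (\<lambda>\<omega>. ?k (?Z (Some ` hist t) \<omega>))
        = measure_pmf.expectation (Pi_pmf (Some ` hist t) undefined ?p) ?k"
      using indep fin(2) S
      by (rule expectation_indep_uniform(2)) (use U[where t = t] in blast)+
    moreover have "expectation (\<lambda>\<omega>. h (sample \<omega>)) = hist_exp t h"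
      using cong by (rule expectation_hist(2))
    ultimately show ?thesis by (simp only: hS)
  qed
  also have "measure_pmf.expectation (?p None) (\<lambda>y. of_bool (y = r) * hist_exp t h)
      = hist_exp t h / real T"
    using T r by (simp add: family_range_def integral_pmf_of_set flip: sum_distrib_right)
  finally show "expectation (\<lambda>\<omega>. of_bool (tout \<omega> = r) * h (sample \<omega>)) = hist_exp t h / real T" .
qed

text \<open>Splitting by the value of \<open>tout\<close> reduces the expectation to fixed times,
  where \<open>h\<close> is replaced by the decrease before independence is used; the decreases then
  sum up to at most \<open>Delta_f\<close>.\<close>

lemma output_expectation:
  fixes h :: "('m, 'a) cgt_state \<Rightarrow> real"
  assumes bound: "AE \<omega> in M. \<forall>t. h (run x0 (sample \<omega>) t)
      \<le> C * decrease (run x0 (sample \<omega>) t) (batch (sample \<omega>) t)"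
    and C: "C \<ge> 0"
  shows "integrable M (\<lambda>\<omega>. h (run x0 (sample \<omega>) (tout \<omega>)))"
    and "expectation (\<lambda>\<omega>. h (run x0 (sample \<omega>) (tout \<omega>))) \<le> C * Delta_f n F LL r0 \<eta> x0 / real T"
proof -
  define H where "H = (\<lambda>t z. h (run x0 z t))"
  define D where "D = (\<lambda>t z. C * decrease (run x0 z t) (batch z t))"
  have Hc: "H t z = H t z'" if "\<And>j. j \<in> hist t \<Longrightarrow> z j = z' j" for t z z'
    unfolding H_def using run_cong[of t z z' x0] that by simp
  have Dc: "D t z = D t z'" if "\<And>j. j \<in> hist (Suc t) \<Longrightarrow> z j = z' j" for t z z'
  proof -
    have "run x0 z t = run x0 z' t" using that by (intro run_cong) (simp add: hist_Suc)
    moreover have "decrease s (batch z t) = decrease s (batch z' t)" for s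
      using that by (intro decrease_cong) (simp add: batch_def hist_def)
    ultimately show ?thesis by (simp add: D_def)
  qed
  have intH: "integrable M (\<lambda>\<omega>. of_bool (tout \<omega> = t) * H t (sample \<omega>))"
    and intD: "integrable M (\<lambda>\<omega>. of_bool (tout \<omega> = t) * D t (sample \<omega>))"
    and eD: "expectation (\<lambda>\<omega>. of_bool (tout \<omega> = t) * D t (sample \<omega>)) = C * mean_decrease x0 t / real T"
    if "t < T" for t
  proof -
    show "integrable M (\<lambda>\<omega>. of_bool (tout \<omega> = t) * H t (sample \<omega>))"
      using Hc that by (rule expectation_at_tout)
    show "integrable M (\<lambda>\<omega>. of_bool (tout \<omega> = t) * D t (sample \<omega>))"
      using Dc that by (rule expectation_at_tout)
    have "expectation (\<lambda>\<omega>. of_bool (tout \<omega> = t) * D t (sample \<omega>)) = hist_exp (Suc t) (D t) / real T"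
      using Dc that by (rule expectation_at_tout)
    then show "expectation (\<lambda>\<omega>. of_bool (tout \<omega> = t) * D t (sample \<omega>)) = C * mean_decrease x0 t / real T"
      by (simp add: D_def mean_decrease_def hist_exp_def)
  qed
  have AE_eq: "AE \<omega> in M. (\<Sum>t<T. of_bool (tout \<omega> = t) * H t (sample \<omega>)) = H (tout \<omega>) (sample \<omega>)"
    using AE_tout
  proof eventually_elim
    case (elim \<omega>)
    have "(\<Sum>t<T. of_bool (tout \<omega> = t) * H t (sample \<omega>))
        = (\<Sum>t<T. if t = tout \<omega> then H t (sample \<omega>) else 0)"
      by (intro sum.cong) auto
    with elim show ?case by simp
  qed
  have meas: "(\<lambda>\<omega>. H (tout \<omega>) (sample \<omega>)) \<in> borel_measurable M"
  proof (rule measurable_compose_countable[OF _ tout_measurable])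
    show "(\<lambda>\<omega>. H t (sample \<omega>)) \<in> borel_measurable M" for t
      using expectation_hist(1)[OF Hc] by (rule borel_measurable_integrable)
  qed
  have intS: "integrable M (\<lambda>\<omega>. \<Sum>t<T. of_bool (tout \<omega> = t) * H t (sample \<omega>))"
    using intH by (intro Bochner_Integration.integrable_sum) simp
  then have "integrable M (\<lambda>\<omega>. H (tout \<omega>) (sample \<omega>))"
    using AE_eq meas borel_measurable_integrable integrable_cong_AE_imp by blast
  then show "integrable M (\<lambda>\<omega>. h (run x0 (sample \<omega>) (tout \<omega>)))" by (simp add: H_def)
  have "expectation (\<lambda>\<omega>. H (tout \<omega>) (sample \<omega>))
      = expectation (\<lambda>\<omega>. \<Sum>t<T. of_bool (tout \<omega> = t) * H t (sample \<omega>))"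
    using AE_eq meas borel_measurable_integrable[OF intS] by (intro integral_cong_AE) auto
  also have "\<dots> = (\<Sum>t<T. expectation (\<lambda>\<omega>. of_bool (tout \<omega> = t) * H t (sample \<omega>)))"
    using intH by (intro Bochner_Integration.integral_sum) simp
  also have "\<dots> \<le> (\<Sum>t<T. C * mean_decrease x0 t / real T)"
  proof (rule sum_mono)
    fix t assume "t \<in> {..<T}"
    then have t: "t < T" by simp
    have "expectation (\<lambda>\<omega>. of_bool (tout \<omega> = t) * H t (sample \<omega>))
        \<le> expectation (\<lambda>\<omega>. of_bool (tout \<omega> = t) * D t (sample \<omega>))"
    proof (intro integral_mono_AE intH intD t)
      show "AE \<omega> in M. of_bool (tout \<omega> = t) * H t (sample \<omega>) \<le> of_bool (tout \<omega> = t) * D t (sample \<omega>)"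
        using bound by eventually_elim (auto simp: H_def D_def)
    qed
    then show "expectation (\<lambda>\<omega>. of_bool (tout \<omega> = t) * H t (sample \<omega>)) \<le> C * mean_decrease x0 t / real T"
      by (simp add: eD[OF t])
  qed
  also have "\<dots> = C * (\<Sum>t<T. mean_decrease x0 t) / real T"
    by (simp add: sum_distrib_left sum_divide_distrib)
  also have "\<dots> \<le> C * Delta_f n F LL r0 \<eta> x0 / real T"
    using C by (intro divide_right_mono mult_left_mono sum_mean_decrease) auto
  finally show "expectation (\<lambda>\<omega>. h (run x0 (sample \<omega>) (tout \<omega>)))
      \<le> C * Delta_f n F LL r0 \<eta> x0 / real T" by (simp add: H_def)
qed

end


subsection \<open>The convergence rate\<close>

theorem theorem4p6:
  fixes n :: "'m::finite \<Rightarrow> nat"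
    and F :: "'m \<Rightarrow> nat \<Rightarrow> real^'d \<Rightarrow> real"
    and LL :: "'m \<Rightarrow> (real^'d) set \<Rightarrow> real"
    and W :: "real^'m^'m" and E :: "('m \<times> 'm) set"
    and \<eta> c \<gamma> \<delta> \<rho> \<theta> r0 Lbar :: real
    and \<tau> B :: "'m \<Rightarrow> nat" and x0 :: "real^'d" and T :: nat
    and M :: "'w measure"
    and \<xi> :: "nat \<Rightarrow> 'm \<Rightarrow> nat \<Rightarrow> 'w \<Rightarrow> nat"
    and tout :: "'w \<Rightarrow> nat"
    and st :: "nat \<Rightarrow> 'w \<Rightarrow> ('m, real^'d) cgt_state"
  \<comment> \<open>the problem\<close>
  assumes n_pos: "\<And>i. n i \<ge> 1"
    and diff: "\<And>i j x. j \<in> {1..n i} \<Longrightarrow> F i j differentiable (at x)"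
  \<comment> \<open>(A1)\<close>
    and A1_pos: "\<And>i X. X \<in> ncompacts \<Longrightarrow> LL i X > 0"
    and A1_lip: "\<And>i X x x'. X \<in> ncompacts \<Longrightarrow> x \<in> X \<Longrightarrow> x' \<in> X \<Longrightarrow>
      (1 / real (n i)) * (\<Sum>j=1..n i. (norm (grad (F i j) x - grad (F i j) x'))\<^sup>2)
        \<le> (LL i X)\<^sup>2 * (norm (x - x'))\<^sup>2"
    and A1_mono: "\<And>i X Y. X \<in> ncompacts \<Longrightarrow> Y \<in> ncompacts \<Longrightarrow> X \<subseteq> Y \<Longrightarrow> LL i X \<le> LL i Y"
    and A1_union: "\<And>i X Y. X \<in> ncompacts \<Longrightarrow> Y \<in> ncompacts \<Longrightarrow>
      LL i (X \<union> Y) = max (LL i X) (LL i Y)"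
    and A1_ge1: "\<And>i X. X \<in> ncompacts \<Longrightarrow> LL i X \<ge> 1"
  \<comment> \<open>(A2)\<close>
    and A2: "\<And>i. RUC (LL i)"
  \<comment> \<open>(A3)\<close>
    and A3: "bdd_below (range (global_obj n F))"
  \<comment> \<open>(A4)\<close>
    and A4_undirected: "sym E"
    and A4_zero: "\<And>i j. (i, j) \<notin> E \<Longrightarrow> W $ i $ j = 0"
    and A4_pos: "\<And>i j. (i, j) \<in> E \<Longrightarrow> W $ i $ j > 0"
    and A4_row: "W *v ones = ones"
    and A4_col: "transpose W *v ones = ones"
    and A4_norm: "spectral_norm (W - (\<chi> i j. 1 / real CARD('m))) = \<eta>"
    and A4_eta: "0 < \<eta>" "\<eta> < 1"
  \<comment> \<open>constants and parameter choices\<close>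
    and c_eq: "c = 2 * sqrt (2 * real CARD('m)) / (1 - \<eta>)"
    and \<gamma>_eq: "\<gamma> = min 2 ((1 + \<eta>) / (2 * \<eta>))"
    and r0_pos: "r0 > 0"
    and r0_radius: "\<And>i X Y. X \<in> ncompacts \<Longrightarrow> Y \<in> ncompacts \<Longrightarrow> hausdorff_dist X Y \<le> r0 \<Longrightarrow>
      1 / \<gamma> \<le> LL i X / LL i Y \<and> LL i X / LL i Y \<le> \<gamma>"
    and \<delta>_pos: "\<delta> > 0" and \<rho>_pos: "\<rho> > 0"
    and radius: "(c + 1) * \<delta> + \<rho> \<le> r0"
    and \<tau>_pos: "\<And>i. \<tau> i \<ge> 1"
    and batch: "\<And>i. B i = \<tau> i"
    and \<theta>_ge: "\<theta> \<ge> 28 + 1424 / (1 - \<eta>)\<^sup>2 + 9600 / (1 - \<eta>) ^ 4"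
  \<comment> \<open>sampling: all batch indices and the output time are mutually independent and uniform\<close>
    and prob: "prob_space M"
    and indep: "prob_space.indep_vars M (\<lambda>_. count_space UNIV)
      (case_option tout (\<lambda>(t, i, k). \<xi> t i k))
      (insert None (Some ` {(t, i, k). k < B i}))"
    and \<xi>_unif: "\<And>t i k. k < B i \<Longrightarrow>
      distr M (count_space UNIV) (\<xi> t i k) = measure_pmf (pmf_of_set {1..n i})"
    and T: "T \<ge> 1"
    and tout_unif: "distr M (count_space UNIV) tout = measure_pmf (pmf_of_set {0..<T})"
  \<comment> \<open>the run of the algorithm\<close>
    and st_eq: "st = (\<lambda>t \<omega>. cgt_run W n F LL \<delta> \<rho> \<theta> r0 \<tau> B x0 (\<lambda>t i k. \<xi> t i k \<omega>) t)"
    and Lbar_pos: "Lbar > 0"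
    and Lbar: "AE \<omega> in M. \<forall>t. Lmin LL r0 (st t \<omega>) \<le> Lbar"
  shows "integrable M (\<lambda>\<omega>. (norm (grad_map n F LL \<delta> \<theta> r0 (st (tout \<omega>) \<omega>)))\<^sup>2) \<and>
      (\<integral>\<omega>. (norm (grad_map n F LL \<delta> \<theta> r0 (st (tout \<omega>) \<omega>)))\<^sup>2 \<partial>M)
        \<le> 32 * \<theta>\<^sup>2 * Lbar * Delta_f n F LL r0 \<eta> x0 / ((\<theta> - 2) * real T) \<and>
      (\<forall>i. integrable M (\<lambda>\<omega>. (1 / real CARD('m)) *
              (norm (iter (st (tout \<omega>) \<omega>) i - avg (iter (st (tout \<omega>) \<omega>))))\<^sup>2) \<and>
         (\<integral>\<omega>. (1 / real CARD('m)) *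
              (norm (iter (st (tout \<omega>) \<omega>) i - avg (iter (st (tout \<omega>) \<omega>))))\<^sup>2 \<partial>M)
           \<le> 4 * Delta_f n F LL r0 \<eta> x0 / (3 * real T))"
proof -
  have B: "B = \<tau>" using batch by auto
  have W_nonneg: "W $ i $ j \<ge> 0" for i j
    using A4_zero[of i j] A4_pos[of i j] by (cases "(i, j) \<in> E") auto
  interpret prob_space M by (rule prob)
  interpret cgt_random n F LL W \<eta> \<gamma> \<delta> \<rho> \<theta> r0 \<tau> M x0 "\<lambda>(t, i, k). \<xi> t i k" tout T
    by unfold_locales
      (use assms in \<open>auto simp: B W_nonneg\<close>)
  have st: "st t \<omega> = run x0 (sample \<omega>) t" for t \<omega>
    by (simp add: st_eq run_def sample_def B)
  have \<theta>2: "\<theta> > 2" using \<theta>_large by simp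
  let ?\<Delta> = "Delta_f n F LL r0 \<eta> x0"
  have "AE \<omega> in M. \<forall>t. (norm (grad_map n F LL \<delta> \<theta> r0 (run x0 (sample \<omega>) t)))\<^sup>2
      \<le> 32 * \<theta> * Lbar * decrease (run x0 (sample \<omega>) t) (batch (sample \<omega>) t)"
    using Lbar
  proof eventually_elim
    case (elim \<omega>)
    show ?case
    proof
      fix t
      let ?s = "run x0 (sample \<omega>) t" and ?b = "batch (sample \<omega>) t"
      have "(norm (grad_map n F LL \<delta> \<theta> r0 ?s))\<^sup>2 \<le> 32 * \<theta> * Lm ?s * decrease ?s ?b"
        by (intro norm_grad_map_sq_le inv_run)
      also have "\<dots> \<le> 32 * \<theta> * Lbar * decrease ?s ?b"
        using elim \<theta>_pos by (intro mult_right_mono mult_left_mono decrease_nonneg inv_run) (auto simp: st)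
      finally show "(norm (grad_map n F LL \<delta> \<theta> r0 ?s))\<^sup>2 \<le> 32 * \<theta> * Lbar * decrease ?s ?b" .
    qed
  qed
  note G = output_expectation[OF this]
  have nonneg: "0 \<le> 32 * \<theta> * Lbar" using \<theta>_pos Lbar_pos by simp
  \<comment> \<open>The sign of the right-hand side is read off from the bound itself: it dominates
    the integral of a square.\<close>
  have "0 \<le> (\<integral>\<omega>. (norm (grad_map n F LL \<delta> \<theta> r0 (run x0 (sample \<omega>) (tout \<omega>))))\<^sup>2 \<partial>M)"
    by (intro integral_nonneg_AE) auto
  with G(2)[OF nonneg] have C: "0 \<le> 32 * \<theta> * Lbar * ?\<Delta> / real T" by linarith
  \<comment> \<open>The factor \<open>\<theta> / (\<theta> - 2)\<close>, at least 1, brings the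
    bound into the stated form.\<close>
  have "32 * \<theta> * Lbar * ?\<Delta> / real T \<le> 32 * \<theta> * Lbar * ?\<Delta> / real T * (\<theta> / (\<theta> - 2))"
    using mult_left_mono[of 1 "\<theta> / (\<theta> - 2)", OF _ C] \<theta>2 by (simp only: mult_1_right) simp
  also have "\<dots> = 32 * \<theta>\<^sup>2 * Lbar * ?\<Delta> / ((\<theta> - 2) * real T)"
    by (simp add: power2_eq_square mult_ac)
  finally have "32 * \<theta> * Lbar * ?\<Delta> / real T \<le> 32 * \<theta>\<^sup>2 * Lbar * ?\<Delta> / ((\<theta> - 2) * real T)" .
  moreover have "AE \<omega> in M. \<forall>t. (1 / real CARD('m)) *
      (norm (iter (run x0 (sample \<omega>) t) i - avg (iter (run x0 (sample \<omega>) t))))\<^sup>2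
      \<le> 4 / 3 * decrease (run x0 (sample \<omega>) t) (batch (sample \<omega>) t)" for i
    by (intro AE_I2 allI consensus_le_decrease inv_run)
  note K = output_expectation[OF this]
  ultimately show ?thesis
    unfolding st using G[OF nonneg] K by auto
qed

end
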